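(* Let $k\ge 2$ and let $T$ be a $k$-uniform hypertree on $n$ vertices, where $\frac{n-1}{k-1}\ge 1$. Then $\rho(T)\ge\rho(S_{n,k})$, with equality if and only if $T\cong S_{n,k}$.
   Context: All hypergraphs are finite. A hypergraph $G$ consists of a nonempty vertex set $V(G)$ and an edge set $E(G)$ whose elements are nonempty subsets of $V(G)$. It is $k$-uniform ($k\ge 2$) if every edge has exactly $k$ vertices. A walk of length $p$ from $u$ to $v$ is a sequence $(v_0,e_1,v_1,\dots,v_{p-1},e_p,v_p)$ with $v_0=u$, $v_p=v$, each $e_i$ an edge containing $v_{i-1}$ and $v_i$, and $v_{i-1}\ne v_i$. A path is a walk with all $v_i$ distinct and all $e_i$ distinct; a single vertex is a path of length $0$. A cycle is a walk with at least two edges in which all $e_i$ are distinct and all $v_i$ are distinct except that the first and last vertices coincide. $G$ is connected if there is a path between any two vertices. A hypertree is a connected hypergraph with no cycles; a $k$-uniform hypertree with $m$ edges has order $n=1+(k-1)m$. For connected $G$, the distance $d_G(u,v)$ is the length of a shortest path from $u$ to $v$ (with $d_G(u,u)=0$), the distance matrix is $D(G)=(d_G(u,v))_{u,v\in V(G)}$, and the distance spectral radius $\rho(G)$ is the largest eigenvalue of $D(G)$. The hyperstar $S_{n,k}$ of order $n=1+(k-1)m$ with center $u$ is the $k$-uniform hypertree whose vertex set is a disjoint union $\{u\}\cup V_1\cup\dots\cup V_m$ with $|V_1|=\dots=|V_m|=k-1$ and whose edges are $\{u\}\cup V_i$, $1\le i\le m$. *)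

theory Defs
  imports "Jordan_Normal_Form.Spectral_Radius"
begin

record 'a hypergraph =
  verts :: "'a set"
  edges :: "'a set set"

definition hypergraph :: "'a hypergraph \<Rightarrow> bool" where
  "hypergraph G \<longleftrightarrow> finite (verts G) \<and> verts G \<noteq> {} \<and> (\<forall>e\<in>edges G. e \<noteq> {} \<and> e \<subseteq> verts G)"

definition uniform :: "nat \<Rightarrow> 'a hypergraph \<Rightarrow> bool" where
  "uniform k G \<longleftrightarrow> (\<forall>e\<in>edges G. card e = k)"

(* The walk (v_0, e_1, v_1, ..., e_p, v_p) is given by vs = [v_0, ..., v_p] and
   es = [e_1, ..., e_p]; its length is length es. *)
definition hwalk :: "'a hypergraph \<Rightarrow> 'a \<Rightarrow> 'a list \<Rightarrow> 'a set list \<Rightarrow> 'a \<Rightarrow> bool" where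
  "hwalk G u vs es v \<longleftrightarrow>
     length vs = Suc (length es) \<and> set vs \<subseteq> verts G \<and> set es \<subseteq> edges G \<and>
     hd vs = u \<and> last vs = v \<and>
     (\<forall>i<length es. vs ! i \<in> es ! i \<and> vs ! Suc i \<in> es ! i \<and> vs ! i \<noteq> vs ! Suc i)"

definition hpath :: "'a hypergraph \<Rightarrow> 'a \<Rightarrow> 'a list \<Rightarrow> 'a set list \<Rightarrow> 'a \<Rightarrow> bool" where
  "hpath G u vs es v \<longleftrightarrow> hwalk G u vs es v \<and> distinct vs \<and> distinct es"

definition hcycle :: "'a hypergraph \<Rightarrow> 'a list \<Rightarrow> 'a set list \<Rightarrow> bool" where
  "hcycle G vs es \<longleftrightarrow>
     (\<exists>v. hwalk G v vs es v) \<and> length es \<ge> 2 \<and> distinct es \<and> distinct (butlast vs)"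

definition hconnected :: "'a hypergraph \<Rightarrow> bool" where
  "hconnected G \<longleftrightarrow> (\<forall>u\<in>verts G. \<forall>v\<in>verts G. \<exists>vs es. hpath G u vs es v)"

definition hypertree :: "'a hypergraph \<Rightarrow> bool" where
  "hypertree G \<longleftrightarrow> hypergraph G \<and> hconnected G \<and> (\<nexists>vs es. hcycle G vs es)"

(* Only meaningful when G is connected. *)
definition hdist :: "'a hypergraph \<Rightarrow> 'a \<Rightarrow> 'a \<Rightarrow> nat" where
  "hdist G u v = (LEAST p. \<exists>vs es. hpath G u vs es v \<and> length es = p)"

definition distance_matrix :: "'a hypergraph \<Rightarrow> (nat \<Rightarrow> 'a) \<Rightarrow> real mat" where
  "distance_matrix G f =
     mat (card (verts G)) (card (verts G)) (\<lambda>(i, j). real (hdist G (f i) (f j)))"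

(* Matrices have index set {0..<n}, so the vertices are numbered first. The choice is
   immaterial, see eigenvalue_distance_matrix_iff. As D(G) is real and symmetric, all its
   eigenvalues are real, so the real spectrum is the whole spectrum. *)
definition distance_spectral_radius :: "'a hypergraph \<Rightarrow> real" where
  "distance_spectral_radius G =
     Max (spectrum (distance_matrix G
       (SOME f. bij_betw f {0..<card (verts G)} (verts G))))"

definition hyperiso :: "'a hypergraph \<Rightarrow> 'b hypergraph \<Rightarrow> bool" where
  "hyperiso G H \<longleftrightarrow>
     (\<exists>f. bij_betw f (verts G) (verts H) \<and> edges H = (\<lambda>e. f ` e) ` edges G)"

(* The center is None and V_(i+1) = {Some (i, j) | j < k - 1} for i < m, where
   m = (n - 1) div (k - 1). The division is exact in the case n = 1 + (k - 1) * m
   of interest. *)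
definition hyperstar :: "nat \<Rightarrow> nat \<Rightarrow> (nat \<times> nat) option hypergraph" where
  "hyperstar n k =
     (let m = (n - 1) div (k - 1);
          V = (\<lambda>i. (\<lambda>j. Some (i, j)) ` {..<k - 1})
      in \<lparr>verts = insert None (\<Union>i<m. V i), edges = (\<lambda>i. insert None (V i)) ` {..<m}\<rparr>)"

lemma eigenvalue_distance_matrix_iff:
  assumes f: "bij_betw f {0..<card (verts G)} (verts G)"
  shows "eigenvalue (distance_matrix G f) c \<longleftrightarrow>
    (\<exists>x. (\<exists>v\<in>verts G. x v \<noteq> 0) \<and>
         (\<forall>u\<in>verts G. (\<Sum>v\<in>verts G. real (hdist G u v) * x v) = c * x u))"
    (is "_ \<longleftrightarrow> (\<exists>x. ?P x)")
proof -
  let ?n = "card (verts G)"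
  have sm: "(\<Sum>v\<in>verts G. g v) = (\<Sum>j<?n. g (f j))" for g :: "'a \<Rightarrow> real"
    using sum.reindex_bij_betw[OF f, of g] by (simp add: lessThan_atLeast0)
  have fI: "f i \<in> verts G" if "i < ?n" for i
    using f that by (auto simp: bij_betw_def)
  have fE: "\<exists>i<?n. v = f i" if "v \<in> verts G" for v
  proof -
    have "v \<in> f ` {0..<?n}" using f that by (simp only: bij_betw_def)
    then show ?thesis by auto
  qed
  have dm: "dim_row (distance_matrix G f) = ?n"
    by (simp add: distance_matrix_def)
  have mv: "(distance_matrix G f *\<^sub>v w) $ i
        = (\<Sum>j<?n. real (hdist G (f i) (f j)) * w $ j)"
    if "i < ?n" "w \<in> carrier_vec ?n" for w i
    using that by (auto simp: distance_matrix_def scalar_prod_def lessThan_atLeast0)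
  show ?thesis
  proof
    assume "eigenvalue (distance_matrix G f) c"
    then obtain w where w: "w \<in> carrier_vec ?n" "w \<noteq> 0\<^sub>v ?n"
      and ev: "distance_matrix G f *\<^sub>v w = c \<cdot>\<^sub>v w"
      by (auto simp: eigenvalue_def eigenvector_def dm)
    define x where "x v = w $ (the_inv_into {0..<?n} f v)" for v
    have x: "x (f i) = w $ i" if "i < ?n" for i
      unfolding x_def using that f by (simp add: bij_betw_def the_inv_into_f_f)
    obtain i where i: "i < ?n" "w $ i \<noteq> 0"
      using w by (force intro!: eq_vecI)
    have "?P x"
    proof
      show "\<exists>v\<in>verts G. x v \<noteq> 0"
        using i x[OF i(1)] fI[OF i(1)] by (intro bexI[of _ "f i"]) simp_all
      have "(\<Sum>v\<in>verts G. real (hdist G (f l) v) * x v) = c * x (f l)" if l: "l < ?n" for l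
      proof -
        have "(\<Sum>v\<in>verts G. real (hdist G (f l) v) * x v)
            = (\<Sum>j<?n. real (hdist G (f l) (f j)) * w $ j)"
          unfolding sm by (rule sum.cong) (auto simp: x)
        then show ?thesis
          using mv[OF l w(1)] ev l w(1) x[OF l] by simp
      qed
      then show "\<forall>u\<in>verts G. (\<Sum>v\<in>verts G. real (hdist G u v) * x v) = c * x u"
        using fE by blast
    qed
    then show "\<exists>x. ?P x" by blast
  next
    assume "\<exists>x. ?P x"
    then obtain x where x: "?P x" by blast
    define w where "w = vec ?n (\<lambda>i. x (f i))"
    have w: "w \<in> carrier_vec ?n" by (simp add: w_def)
    obtain i where i: "i < ?n" "x (f i) \<noteq> 0"
      using x fE by blast
    have "w $ i \<noteq> 0"
      using i by (simp add: w_def)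
    then have "w \<noteq> 0\<^sub>v ?n"
      using i(1) by auto
    moreover have "distance_matrix G f *\<^sub>v w = c \<cdot>\<^sub>v w"
    proof (rule eq_vecI)
      fix l assume "l < dim_vec (c \<cdot>\<^sub>v w)"
      then have l: "l < ?n" by (simp add: w_def)
      have "f l \<in> verts G" using l fI by blast
      then have "(\<Sum>j<?n. real (hdist G (f l) (f j)) * x (f j)) = c * x (f l)"
        using x unfolding sm by blast
      then show "(distance_matrix G f *\<^sub>v w) $ l = (c \<cdot>\<^sub>v w) $ l"
        using mv[OF l w] l by (simp add: w_def)
    qed (simp add: dm w_def)
    ultimately show "eigenvalue (distance_matrix G f) c"
      using w by (auto simp: eigenvalue_def eigenvector_def dm)
  qed
qed

end

theory Submission
  imports Defs "HOL-Analysis.Function_Topology"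
begin

text \<open>The Perron vector of the hyperstar takes a value \<open>N = n - 1\<close> at the centre and a constant
  value \<open>s\<close> elsewhere. If \<open>T\<close> is not a hyperstar, then it has a vertex \<open>w\<close> that lies in two edges
  and is not adjacent to all other vertices. Put the same two values on \<open>T\<close>, with \<open>N\<close> at \<open>w\<close>,
  and compare Rayleigh quotients. The distances from \<open>w\<close> sum to more than \<open>n - 1\<close>. Among the other
  vertices, \<open>T\<close> has two more adjacent ordered pairs than the hyperstar for every vertex not adjacent
  to \<open>w\<close>, but each such vertex is at distance at least 3 from some neighbour of \<open>w\<close> in a different
  branch, so the distances sum to at least as much as in the hyperstar. Hence the Rayleigh quotient
  of \<open>T\<close> exceeds the spectral radius of the hyperstar.\<close>

section \<open>Rayleigh quotients\<close>

text \<open>First-order condition at an extremum: for small \<open>t\<close> a nonzero linear term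
  would dominate the quadratic one and change sign with \<open>t\<close>.\<close>

lemma psd_form_zero:
  fixes q :: real
  assumes "\<And>t. 0 \<le> 2 * t * q + t\<^sup>2 * r"
  shows "q = 0"
proof (rule ccontr)
  assume q: "q \<noteq> 0"
  \<comment> \<open>Any positive \<open>s\<close> above \<open>r\<close> works: at
    \<open>t = - q / s\<close> the form equals \<open>q^2 / s * (r / s - 2)\<close>, which is
    negative.\<close>
  define s where "s = \<bar>r\<bar> + 1"
  have s: "s > 0" "r < s" by (auto simp: s_def)
  have "0 \<le> 2 * (- q / s) * q + (- q / s)\<^sup>2 * r" by (rule assms)
  also have "\<dots> = q\<^sup>2 / s * (r / s - 2)"
    using s by (simp add: field_simps power2_eq_square)
  also have "\<dots> < 0"
    using s q by (intro mult_pos_neg) (auto simp: field_simps)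
  finally show False by simp
qed

definition qform :: "'a set \<Rightarrow> ('a \<Rightarrow> 'a \<Rightarrow> real) \<Rightarrow> ('a \<Rightarrow> real) \<Rightarrow> real" where
  "qform V M x = (\<Sum>u\<in>V. \<Sum>v\<in>V. M u v * (x u * x v))"

lemma qform_scale: "qform V M (\<lambda>v. c * x v) = c\<^sup>2 * qform V M x"
  by (simp add: qform_def sum_distrib_left power2_eq_square mult_ac)

text \<open>Compactness of the unit sphere gives the maximiser, and scaling by the norm extends the
  bound from the sphere to all \<open>y\<close>.\<close>

lemma qform_max:
  fixes M :: "'a \<Rightarrow> 'a \<Rightarrow> real"
  assumes fin: "finite V" and ne: "V \<noteq> {}"
  obtains x where "(\<Sum>v\<in>V. (x v)\<^sup>2) = 1"
    "\<And>y. qform V M y \<le> qform V M x * (\<Sum>v\<in>V. (y v)\<^sup>2)"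
proof -
  \<comment> \<open>Functions are total on the vertex type, so coordinates outside \<open>V\<close>
    are pinned to 0. This makes \<open>B\<close> a product of compact sets, and the sphere inside it
    is compact in the product topology.\<close>
  define B where "B = (\<Pi>\<^sub>E i\<in>UNIV. if i \<in> V then {-1..1} else {0::real})"
  define S where "S = B \<inter> {x. (\<Sum>v\<in>V. (x v)\<^sup>2) = 1}"
  have "compactin (product_topology (\<lambda>i. euclidean) UNIV) B"
    unfolding B_def compactin_PiE by auto
  then have B: "compact B"
    by (simp add: euclidean_product_topology)
  have coord: "continuous_on A (\<lambda>x::'a \<Rightarrow> real. x v)" for A v
    by (rule continuous_on_subset[OF continuous_on_product_coordinates]) auto
  have "closed {x::'a \<Rightarrow> real. (\<Sum>v\<in>V. (x v)\<^sup>2) = 1}"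
    by (rule closed_Collect_eq) (intro continuous_intros coord)+
  with B have S: "compact S"
    unfolding S_def by (rule compact_Int_closed)
  obtain w where w: "w \<in> V" using ne by blast
  have "(\<lambda>v. if v = w then 1 else 0) \<in> S"
    using w fin by (auto simp: S_def B_def if_distrib[of "\<lambda>x. x\<^sup>2"] cong: if_cong)
  then have "S \<noteq> {}" by blast
  moreover have "continuous_on S (qform V M)"
    unfolding qform_def by (intro continuous_intros coord)
  ultimately obtain x where x: "x \<in> S" "\<And>y. y \<in> S \<Longrightarrow> qform V M y \<le> qform V M x"
    using continuous_attains_sup[OF S] by metis
  have "qform V M y \<le> qform V M x * (\<Sum>v\<in>V. (y v)\<^sup>2)" for y
  proof (cases "(\<Sum>v\<in>V. (y v)\<^sup>2) = 0")
    case True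
    then have "\<forall>v\<in>V. y v = 0" using fin by (simp add: sum_nonneg_eq_0_iff)
    then have "qform V M y = 0" by (simp add: qform_def)
    then show ?thesis using True by simp
  next
    case False
    define N where "N = (\<Sum>v\<in>V. (y v)\<^sup>2)"
    have N: "N > 0" using False unfolding N_def by (simp add: sum_nonneg order_less_le)
    define c where "c = 1 / sqrt N"
    \<comment> \<open>The normalised \<open>y\<close> is cut off outside \<open>V\<close> so that it
      lies in \<open>B\<close>; \<open>qform\<close> only sees the values on
      \<open>V\<close>.\<close>
    define z where "z v = (if v \<in> V then c * y v else 0)" for v
    have c: "c\<^sup>2 = 1 / N" using N by (simp add: c_def power_divide)
    have z1: "(\<Sum>v\<in>V. (z v)\<^sup>2) = 1"
      using N by (simp add: z_def power_mult_distrib c flip: sum_divide_distrib N_def)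
    have "\<bar>z v\<bar> \<le> 1" if "v \<in> V" for v
    proof -
      have "(z v)\<^sup>2 \<le> (\<Sum>v\<in>V. (z v)\<^sup>2)" using that fin by (intro member_le_sum) auto
      then show ?thesis unfolding z1 by (simp add: abs_square_le_1)
    qed
    then have "z \<in> B" by (auto simp: B_def z_def abs_le_iff dest: minus_le_iff[THEN iffD1])
    then have "qform V M z \<le> qform V M x" using z1 x by (simp add: S_def)
    moreover have "qform V M z = qform V M (\<lambda>v. c * y v)"
      by (auto simp: qform_def z_def intro!: sum.cong)
    ultimately have "qform V M y / N \<le> qform V M x" by (simp add: qform_scale c)
    then show ?thesis using N by (simp add: field_simps flip: N_def)
  qed
  with x show ?thesis using that by (auto simp: S_def)
qed

text \<open>The maximiser of the Rayleigh quotient is an eigenvector: its variation in the direction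
  of each unit vector has to vanish to first order.\<close>

lemma rayleigh_eigen:
  fixes M :: "'a \<Rightarrow> 'a \<Rightarrow> real"
  assumes fin: "finite V" and ne: "V \<noteq> {}" and sym: "\<And>u v. u \<in> V \<Longrightarrow> v \<in> V \<Longrightarrow> M u v = M v u"
  obtains l x where "\<exists>v\<in>V. x v \<noteq> 0" "\<forall>u\<in>V. (\<Sum>v\<in>V. M u v * x v) = l * x u"
    "\<And>y. qform V M y \<le> l * (\<Sum>v\<in>V. (y v)\<^sup>2)"
proof -
  obtain x where x1: "(\<Sum>v\<in>V. (x v)\<^sup>2) = 1"
    and mx: "\<And>y. qform V M y \<le> qform V M x * (\<Sum>v\<in>V. (y v)\<^sup>2)"
    using qform_max[OF fin ne] by blast
  define l where "l = qform V M x"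
  have "(\<Sum>v\<in>V. M u v * x v) = l * x u" if u: "u \<in> V" for u
  proof -
    define g where "g = (\<Sum>v\<in>V. M u v * x v)"
    \<comment> \<open>This is the maximality of \<open>x\<close> tested on \<open>x + t * d\<close>,
      with \<open>d\<close> the indicator of \<open>u\<close>.\<close>
    have "0 \<le> 2 * t * (l * x u - g) + t\<^sup>2 * (l - M u u)" for t
    proof -
      define d :: "'a \<Rightarrow> real" where "d v = (if v = u then 1 else 0)" for v
      have dl: "(\<Sum>v\<in>V. f v * d v) = f u" for f :: "'a \<Rightarrow> real"
        using u fin by (simp add: d_def if_distrib cong: if_cong)
      have "qform V M (\<lambda>v. x v + t * d v) = qform V M x
          + t * (\<Sum>v\<in>V. (\<Sum>w\<in>V. M v w * x w) * d v)
          + t * (\<Sum>v\<in>V. (\<Sum>w\<in>V. M v w * x v * d w))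
          + t\<^sup>2 * (\<Sum>v\<in>V. (\<Sum>w\<in>V. M v w * d w) * d v)"
        unfolding qform_def
        by (simp add: algebra_simps sum.distrib sum_distrib_left sum_distrib_right power2_eq_square)
      also have "\<dots> = l + t * g + t * (\<Sum>v\<in>V. M v u * x v) + t\<^sup>2 * M u u"
        unfolding dl by (simp add: l_def g_def)
      also have "(\<Sum>v\<in>V. M v u * x v) = g"
        unfolding g_def using sym u by (intro sum.cong) auto
      finally have q: "qform V M (\<lambda>v. x v + t * d v) = l + 2 * t * g + t\<^sup>2 * M u u" by simp
      have "(\<Sum>v\<in>V. (x v + t * d v)\<^sup>2)
          = (\<Sum>v\<in>V. (x v)\<^sup>2) + (\<Sum>v\<in>V. (2 * t * x v) * d v) + (\<Sum>v\<in>V. (t\<^sup>2 * d v) * d v)"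
        by (simp add: power2_eq_square algebra_simps sum.distrib)
      also have "\<dots> = 1 + 2 * t * x u + t\<^sup>2"
        unfolding dl x1 by (simp add: d_def)
      finally show ?thesis
        using mx[of "\<lambda>v. x v + t * d v"] unfolding q l_def[symmetric] by (simp add: algebra_simps)
    qed
    from psd_form_zero[OF this] show ?thesis by (simp add: g_def)
  qed
  moreover have "\<exists>v\<in>V. x v \<noteq> 0"
    using x1 by (metis (no_types, lifting) sum.neutral zero_neq_one zero_power2)
  ultimately show ?thesis using that mx unfolding l_def by blast
qed

text \<open>Pair \<open>|y|\<close> with the positive eigenvector \<open>x\<close>: entrywise
  \<open>c * |y|\<close> is at most \<open>M |y|\<close>, and symmetry moves \<open>M\<close> onto
  \<open>x\<close>, where it acts as \<open>l\<close>. Hence a positive eigenvector belongs to the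
  largest eigenvalue.\<close>

lemma eigenvalue_le_positive:
  fixes M :: "'a \<Rightarrow> 'a \<Rightarrow> real"
  assumes fin: "finite V" and sym: "\<And>u v. u \<in> V \<Longrightarrow> v \<in> V \<Longrightarrow> M u v = M v u"
    and nonneg: "\<And>u v. u \<in> V \<Longrightarrow> v \<in> V \<Longrightarrow> M u v \<ge> 0"
    and pos: "\<And>v. v \<in> V \<Longrightarrow> x v > 0"
    and x: "\<And>u. u \<in> V \<Longrightarrow> (\<Sum>v\<in>V. M u v * x v) = l * x u"
    and y0: "\<exists>v\<in>V. y v \<noteq> 0"
    and y: "\<And>u. u \<in> V \<Longrightarrow> (\<Sum>v\<in>V. M u v * y v) = c * y u"
  shows "c \<le> l"
proof -
  have "c * (\<Sum>u\<in>V. x u * \<bar>y u\<bar>) \<le> (\<Sum>u\<in>V. x u * (\<Sum>v\<in>V. M u v * \<bar>y v\<bar>))"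
    unfolding sum_distrib_left
  proof (rule sum_mono)
    fix u assume u: "u \<in> V"
    have "c * \<bar>y u\<bar> \<le> \<bar>c * y u\<bar>" by (simp add: abs_mult mult_right_mono)
    also have "\<dots> = \<bar>\<Sum>v\<in>V. M u v * y v\<bar>" using y[OF u] by simp
    also have "\<dots> \<le> (\<Sum>v\<in>V. \<bar>M u v * y v\<bar>)" by (rule sum_abs)
    also have "\<dots> = (\<Sum>v\<in>V. M u v * \<bar>y v\<bar>)"
      using nonneg u by (intro sum.cong) (auto simp: abs_mult)
    finally have "x u * (c * \<bar>y u\<bar>) \<le> x u * (\<Sum>v\<in>V. M u v * \<bar>y v\<bar>)"
      using pos[OF u] by (intro mult_left_mono) auto
    then show "c * (x u * \<bar>y u\<bar>) \<le> (\<Sum>v\<in>V. x u * (M u v * \<bar>y v\<bar>))"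
      by (simp add: sum_distrib_left mult.left_commute)
  qed
  also have "\<dots> = (\<Sum>v\<in>V. (\<Sum>u\<in>V. M v u * x u) * \<bar>y v\<bar>)"
    unfolding sum_distrib_left sum_distrib_right
    by (subst sum.swap) (auto intro!: sum.cong simp: sym)
  also have "\<dots> = l * (\<Sum>u\<in>V. x u * \<bar>y u\<bar>)"
    by (simp add: x sum_distrib_left mult.assoc)
  finally have "c * (\<Sum>u\<in>V. x u * \<bar>y u\<bar>) \<le> l * (\<Sum>u\<in>V. x u * \<bar>y u\<bar>)" .
  moreover have "(\<Sum>u\<in>V. x u * \<bar>y u\<bar>) > 0"
    using y0 fin pos by (force intro!: sum_pos2 simp: less_imp_le)
  ultimately show ?thesis by simp
qed

section \<open>Walks and distances\<close>

text \<open>The edge set is a parameter because the cycle arguments walk in the hypergraph with one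
  edge deleted.\<close>

definition adjr :: "'a set set \<Rightarrow> ('a \<times> 'a) set" where
  "adjr F = {(x, y). x \<noteq> y \<and> (\<exists>e\<in>F. x \<in> e \<and> y \<in> e)}"

lemma adjrI: "e \<in> F \<Longrightarrow> x \<in> e \<Longrightarrow> y \<in> e \<Longrightarrow> x \<noteq> y \<Longrightarrow> (x, y) \<in> adjr F"
  by (auto simp: adjr_def)

lemma sym_adjr: "sym (adjr F)"
  by (auto simp: adjr_def sym_def)

lemma adjr_rtrancl_sym: "(x, y) \<in> (adjr F)\<^sup>* \<Longrightarrow> (y, x) \<in> (adjr F)\<^sup>*"
  using sym_rtrancl[OF sym_adjr, of F] by (rule symD)

lemma adjr_relpow_sym: "(x, y) \<in> adjr F ^^ n \<Longrightarrow> (y, x) \<in> adjr F ^^ n"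
proof (induction n arbitrary: y)
  case (Suc n)
  then obtain z where "(x, z) \<in> adjr F ^^ n" "(z, y) \<in> adjr F" by auto
  then show ?case
    using Suc.IH symD[OF sym_adjr] relpow_Suc_I2 by metis
qed auto

lemma hwalk_imp_relpow:
  assumes "hwalk G u vs es v"
  shows "(u, v) \<in> adjr (edges G) ^^ length es"
  unfolding relpow_fun_conv
proof (intro exI[of _ "(!) vs"] conjI allI impI)
  have "vs \<noteq> []" using assms by (auto simp: hwalk_def)
  then show "vs ! 0 = u" "vs ! length es = v"
    using assms by (auto simp: hwalk_def hd_conv_nth last_conv_nth)
  show "(vs ! i, vs ! Suc i) \<in> adjr (edges G)" if "i < length es" for i
  proof (rule adjrI)
    show "es ! i \<in> edges G"
      using assms nth_mem[OF that] unfolding hwalk_def by blast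
  qed (use assms that in \<open>auto simp: hwalk_def\<close>)
qed

text \<open>A shortest walk repeats neither a vertex nor an edge: any repetition yields a shortcut.\<close>

lemma minimal_relpow_imp_hpath:
  assumes G: "hypergraph G" and F: "F \<subseteq> edges G" and u: "u \<in> verts G"
    and uv: "(u, v) \<in> adjr F ^^ n" and mn: "\<And>j. j < n \<Longrightarrow> (u, v) \<notin> adjr F ^^ j"
  shows "\<exists>vs es. hpath G u vs es v \<and> length es = n \<and> set es \<subseteq> F"
proof -
  obtain f where f: "f 0 = u" "f n = v" "\<And>i. i < n \<Longrightarrow> (f i, f (Suc i)) \<in> adjr F"
    using uv unfolding relpow_fun_conv by blast
  have "\<forall>i<n. \<exists>e\<in>F. f i \<in> e \<and> f (Suc i) \<in> e \<and> f i \<noteq> f (Suc i)"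
    using f(3) by (force simp: adjr_def)
  then obtain g where g: "\<And>i. i < n \<Longrightarrow> g i \<in> F \<and> f i \<in> g i \<and> f (Suc i) \<in> g i \<and> f i \<noteq> f (Suc i)"
    by metis
  have pre: "(u, f i) \<in> adjr F ^^ i" if "i \<le> n" for i
    unfolding relpow_fun_conv using f that by (intro exI[of _ f]) auto
  have suf: "(f i, v) \<in> adjr F ^^ (n - i)" if "i \<le> n" for i
    unfolding relpow_fun_conv using f that by (intro exI[of _ "\<lambda>j. f (i + j)"]) auto
  have short: False if "i \<le> n" "j \<le> n" "(f i, f j) \<in> adjr F ^^ d" "i + d < j" for i j d
  proof -
    have "(u, v) \<in> adjr F ^^ (i + d + (n - j))"
      unfolding relpow_add using pre[OF that(1)] that(3) suf[OF that(2)] by blast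
    moreover have "i + d + (n - j) < n" using that by linarith
    ultimately show False using mn by blast
  qed
  have fd: "f i \<noteq> f j" if "i < j" "j \<le> n" for i j
    using short[of i j 0] that by auto
  have gd: "g i \<noteq> g j" if "i < j" "j < n" for i j
  proof
    assume "g i = g j"
    then have "(f i, f (Suc j)) \<in> adjr F"
      using g[of i] g[of j] fd[of i "Suc j"] that by (intro adjrI[of "g i"]) auto
    then have "(f i, f (Suc j)) \<in> adjr F ^^ 1" by simp
    then show False using short[of i "Suc j" 1] that by auto
  qed
  let ?vs = "map f [0..<Suc n]" and ?es = "map g [0..<n]"
  have fv: "f i \<in> verts G" if "i \<le> n" for i
  proof (cases i)
    case (Suc j)
    then show ?thesis using g[of j] that F G by (auto simp: hypergraph_def)
  qed (use f u in auto)
  have "hpath G u ?vs ?es v"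
    unfolding hpath_def hwalk_def
  proof (intro conjI)
    show "set ?vs \<subseteq> verts G" using fv by (auto simp: less_Suc_eq_le simp del: upt_Suc)
    show "set ?es \<subseteq> edges G" using g F by auto
    show "hd ?vs = u" by (simp add: hd_map f del: upt_Suc)
    show "last ?vs = v" using f by simp
    show "\<forall>i<length ?es. ?vs ! i \<in> ?es ! i \<and> ?vs ! Suc i \<in> ?es ! i \<and> ?vs ! i \<noteq> ?vs ! Suc i"
      using g by (auto simp del: upt_Suc)
    show "distinct ?vs"
      unfolding distinct_map by (auto simp: inj_on_def less_Suc_eq_le simp del: upt_Suc)
        (metis fd linorder_neqE_nat)
    show "distinct ?es"
      unfolding distinct_map by (auto simp: inj_on_def) (metis gd linorder_neqE_nat)
  qed simp
  moreover have "set ?es \<subseteq> F" using g by auto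
  ultimately show ?thesis by (intro exI[of _ ?vs] exI[of _ ?es]) auto
qed

text \<open>Containment of the edges in \<open>F\<close> later allows a path that avoids a deleted
  edge to be closed into a cycle by that edge.\<close>

lemma rtrancl_imp_hpath:
  assumes G: "hypergraph G" and F: "F \<subseteq> edges G" and u: "u \<in> verts G"
    and uv: "(u, v) \<in> (adjr F)\<^sup>*"
  shows "\<exists>vs es. hpath G u vs es v \<and> set es \<subseteq> F"
proof -
  obtain m where m: "(u, v) \<in> adjr F ^^ m" using uv rtrancl_imp_relpow by blast
  define n where "n = (LEAST m. (u, v) \<in> adjr F ^^ m)"
  have "(u, v) \<in> adjr F ^^ n" unfolding n_def using m by (rule LeastI)
  moreover have "(u, v) \<notin> adjr F ^^ j" if "j < n" for j
    using that not_less_Least unfolding n_def by blast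
  ultimately show ?thesis using minimal_relpow_imp_hpath[OF G F u] by blast
qed

text \<open>Powers of the adjacency relation are easier to compose and reverse than paths. Every
  path is a walk, and a shortest walk can be realised as a path, so both minima agree.\<close>

lemma hdist_eq_Least:
  assumes G: "hypergraph G" and u: "u \<in> verts G"
  shows "hdist G u v = (LEAST n. (u, v) \<in> adjr (edges G) ^^ n)"
proof -
  let ?A = "\<lambda>p. \<exists>vs es. hpath G u vs es v \<and> length es = p" and ?B = "\<lambda>n. (u, v) \<in> adjr (edges G) ^^ n"
  have AB: "?B p" if "?A p" for p
    using that hwalk_imp_relpow by (auto simp: hpath_def)
  show ?thesis
  proof (cases "Ex ?B")
    case True
    define n where "n = (LEAST n. ?B n)"
    have "?B n" unfolding n_def using True by (rule LeastI_ex)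
    moreover have "\<not> ?B j" if "j < n" for j
      using that not_less_Least unfolding n_def by blast
    ultimately have "?A n"
      using minimal_relpow_imp_hpath[OF G subset_refl u] by blast
    then have "(LEAST p. ?A p) = n"
      by (rule Least_equality) (use AB in \<open>auto simp: n_def intro: Least_le\<close>)
    then show ?thesis by (simp add: hdist_def n_def)
  next
    case False
    \<comment> \<open>Without a walk both predicates are constantly false, so the two
      \<open>LEAST\<close> terms coincide although neither has a witness.\<close>
    then have "?A = ?B" using AB by blast
    then show ?thesis by (simp add: hdist_def)
  qed
qed

lemma adjr_verts: "hypergraph G \<Longrightarrow> (x, y) \<in> adjr (edges G) \<Longrightarrow> x \<in> verts G \<and> y \<in> verts G"
  by (auto simp: adjr_def hypergraph_def)

lemma hdist_le:
  assumes "hypergraph G" "u \<in> verts G" "(u, v) \<in> adjr (edges G) ^^ n"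
  shows "hdist G u v \<le> n"
  using assms by (simp add: hdist_eq_Least Least_le)

section \<open>Metric properties of the distance in connected hypergraphs\<close>

locale conn_hypergraph =
  fixes G :: "'a hypergraph"
  assumes hyp: "hypergraph G" and conn: "hconnected G"
begin

abbreviation "V \<equiv> verts G"
abbreviation "E \<equiv> edges G"
abbreviation "d \<equiv> hdist G"
abbreviation "adj \<equiv> adjr (edges G)"

lemma finite_verts: "finite V" and verts_nonempty: "V \<noteq> {}"
  and edge_subset: "e \<in> E \<Longrightarrow> e \<subseteq> V"
  using hyp by (auto simp: hypergraph_def)

lemma finite_edges: "finite E"
  using finite_verts edge_subset by (meson Pow_iff finite_Pow_iff finite_subset subsetI)

lemma finite_edge: "e \<in> E \<Longrightarrow> finite e"
  using finite_verts edge_subset finite_subset by blast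

lemma relpow_hdist:
  assumes "u \<in> V" "v \<in> V"
  shows "(u, v) \<in> adj ^^ d u v"
proof -
  obtain vs es where "hpath G u vs es v" using conn assms unfolding hconnected_def by blast
  then have "(u, v) \<in> adj ^^ length es"
    using hwalk_imp_relpow[of G u vs es v] by (simp add: hpath_def)
  then have "\<exists>n. (u, v) \<in> adj ^^ n" ..
  then show ?thesis
    unfolding hdist_eq_Least[OF hyp assms(1)] by (rule LeastI_ex)
qed

lemma hdist_commute: "u \<in> V \<Longrightarrow> v \<in> V \<Longrightarrow> d u v = d v u"
  using hdist_le[OF hyp _ adjr_relpow_sym[OF relpow_hdist]] by (blast intro: antisym)

lemma hdist_self: "u \<in> V \<Longrightarrow> d u u = 0"
  using hdist_le[OF hyp, of u u 0] by simp

lemma hdist_eq_0: "u \<in> V \<Longrightarrow> v \<in> V \<Longrightarrow> d u v = 0 \<longleftrightarrow> u = v"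
  using relpow_hdist[of u v] hdist_self by auto

lemma hdist_eq_1:
  assumes "u \<in> V" "v \<in> V"
  shows "d u v = 1 \<longleftrightarrow> (u, v) \<in> adj"
proof
  show "(u, v) \<in> adj" if "d u v = 1"
    using relpow_hdist[OF assms] that by simp
  show "d u v = 1" if "(u, v) \<in> adj"
  proof -
    have "d u v \<le> 1" using hdist_le[OF hyp assms(1), of v 1] that by simp
    moreover have "d u v \<noteq> 0" using that assms by (auto simp: hdist_eq_0 adjr_def)
    ultimately show ?thesis by linarith
  qed
qed

lemma hdist_triangle_adj:
  assumes "u \<in> V" "v \<in> V" "(v, z) \<in> adj"
  shows "d u z \<le> d u v + 1"
proof -
  have "(u, z) \<in> adj ^^ (Suc (d u v))"
    using relpow_Suc_I[OF relpow_hdist[OF assms(1,2)] assms(3)] .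
  then show ?thesis using hdist_le[OF hyp assms(1)] by force
qed

text \<open>The last vertex before \<open>v\<close> on a shortest walk from \<open>w\<close>; it
  serves as a parent of \<open>v\<close> when the hypergraph is rooted at \<open>w\<close>.\<close>

lemma ex_closer_neighbour:
  assumes "w \<in> V" "v \<in> V" "v \<noteq> w"
  obtains p where "(v, p) \<in> adj" "d w v = Suc (d w p)"
proof -
  obtain m where m: "d w v = Suc m" using assms hdist_eq_0[of w v] by (cases "d w v") auto
  with relpow_hdist[OF assms(1,2)] obtain p where p: "(w, p) \<in> adj ^^ m" "(p, v) \<in> adj"
    by auto
  have "d w p \<le> m" using hdist_le[OF hyp assms(1) p(1)] .
  moreover have "d w v \<le> d w p + 1"
    using hdist_triangle_adj[OF assms(1) _ p(2)] adjr_verts[OF hyp p(2)] by blast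
  ultimately show ?thesis using that[of p] p(2) m sym_adjr[of E] by (auto simp: sym_def)
qed

text \<open>Reflexive steps pad shorter walks, so that distances 0, 1 and 2 are treated
  alike.\<close>

lemma relpow_2_cases:
  assumes "u \<in> V" "v \<in> V" "d u v \<le> 2"
  shows "\<exists>y. (u, y) \<in> adj\<^sup>= \<and> (y, v) \<in> adj\<^sup>="
proof -
  have "d u v = 0 \<or> d u v = 1 \<or> d u v = 2" using assms(3) by linarith
  then show ?thesis using relpow_hdist[OF assms(1,2)] by (auto simp: numeral_2_eq_2)
qed

end

section \<open>Hypertrees\<close>

locale hypertree_loc = conn_hypergraph +
  assumes acyclic: "\<nexists>vs es. hcycle G vs es"
begin

text \<open>A path from \<open>x\<close> to \<open>y\<close> that avoids \<open>e\<close> would be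
  closed by \<open>e\<close> into a cycle. Acyclicity enters the later arguments only through this
  lemma.\<close>

lemma edge_separates:
  assumes e: "e \<in> E" and x: "x \<in> e" and y: "y \<in> e" and xy: "x \<noteq> y"
  shows "(x, y) \<notin> (adjr (E - {e}))\<^sup>*"
proof
  assume "(x, y) \<in> (adjr (E - {e}))\<^sup>*"
  then obtain vs es where p: "hpath G x vs es y" and es: "set es \<subseteq> E - {e}"
    using rtrancl_imp_hpath[OF hyp Diff_subset subsetD[OF edge_subset[OF e] x]] by blast
  have w: "hwalk G x vs es y" "distinct vs" "distinct es" using p by (auto simp: hpath_def)
  then have len: "length vs = Suc (length es)" and "vs \<noteq> []" by (auto simp: hwalk_def)
  have ends: "vs ! 0 = x" "vs ! length es = y" "last vs = y"
    using w(1) \<open>vs \<noteq> []\<close> by (auto simp: hwalk_def hd_conv_nth last_conv_nth)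
  then have "es \<noteq> []" using xy by auto
  have "hwalk G x (vs @ [x]) (es @ [e]) x"
    using w(1) e x y xy \<open>vs \<noteq> []\<close> len ends edge_subset[OF e]
    by (auto simp: hwalk_def nth_append less_Suc_eq)
  moreover have "distinct (es @ [e])" using w(3) es by auto
  moreover have "length (es @ [e]) \<ge> 2" using \<open>es \<noteq> []\<close> by (cases es) auto
  ultimately have "hcycle G (vs @ [x]) (es @ [e])" using w(2) by (auto simp: hcycle_def)
  then show False using acyclic by blast
qed

text \<open>Otherwise \<open>f\<close> would still join \<open>x\<close> and \<open>y\<close> after
  the deletion of \<open>e\<close>.\<close>

lemma edges_Int: "e \<in> E \<Longrightarrow> f \<in> E \<Longrightarrow> e \<noteq> f \<Longrightarrow> x \<in> e \<Longrightarrow> y \<in> e \<Longrightarrow> x \<in> f \<Longrightarrow> y \<in> f \<Longrightarrow> x = y"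
  using edge_separates[of e x y] r_into_rtrancl[OF adjrI[of f "E - {e}" x y]] by blast

text \<open>Every edge of a shortest path from \<open>p\<close> to \<open>w\<close> contains a vertex closer to \<open>w\<close> than \<open>p\<close>,
  so it differs from \<open>e\<close>.\<close>

lemma walk_to_root_avoiding:
  assumes w: "w \<in> V" and p: "p \<in> V" and far: "\<And>u. u \<in> e \<Longrightarrow> d w p \<le> d w u"
  shows "(p, w) \<in> (adjr (E - {e}))\<^sup>*"
  using p far
proof (induction "d w p" arbitrary: p)
  case 0
  then have "w = p" using hdist_eq_0[OF w] by metis
  then show ?case by simp
next
  case (Suc m)
  then have "p \<noteq> w" using hdist_self[OF w] by auto
  then obtain q where q: "(p, q) \<in> adj" "d w p = Suc (d w q)"
    using ex_closer_neighbour[OF w Suc.prems(1)] by blast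
  have "(q, w) \<in> (adjr (E - {e}))\<^sup>*"
  proof (rule Suc.hyps(1))
    show "m = d w q" using q(2) Suc.hyps(2) by simp
    show "q \<in> V" using adjr_verts[OF hyp q(1)] by blast
    show "d w q \<le> d w u" if "u \<in> e" for u using Suc.prems(2)[OF that] q(2) by simp
  qed
  moreover have "(p, q) \<in> adjr (E - {e})"
  proof -
    obtain f where f: "f \<in> E" "p \<in> f" "q \<in> f" "p \<noteq> q" using q(1) by (auto simp: adjr_def)
    moreover have "f \<noteq> e" using f(3) Suc.prems(2)[of q] q(2) by auto
    ultimately show ?thesis by (intro adjrI[of f]) auto
  qed
  ultimately show ?case by (rule converse_rtrancl_into_rtrancl[rotated])
qed

text \<open>Two different nearest vertices of \<open>e\<close> could both reach \<open>w\<close>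
  without using \<open>e\<close>, hence also each other.\<close>

lemma nearest_unique:
  assumes w: "w \<in> V" and e: "e \<in> E" and p: "p \<in> e" "\<And>u. u \<in> e \<Longrightarrow> d w p \<le> d w u"
    and q: "q \<in> e" "\<And>u. u \<in> e \<Longrightarrow> d w q \<le> d w u"
  shows "p = q"
proof (rule ccontr)
  assume "p \<noteq> q"
  moreover have "(p, w) \<in> (adjr (E - {e}))\<^sup>*" "(q, w) \<in> (adjr (E - {e}))\<^sup>*"
    using walk_to_root_avoiding[OF w] p q edge_subset[OF e] by blast+
  then have "(p, q) \<in> (adjr (E - {e}))\<^sup>*" by (meson adjr_rtrancl_sym rtrancl_trans)
  ultimately show False using edge_separates[OF e p(1) q(1)] by blast
qed

text \<open>Rooted at \<open>w\<close>, a vertex has only one edge leading towards the root. With a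
  second such edge \<open>f\<close>, one could go from \<open>v\<close> through \<open>q\<close> to
  \<open>w\<close> and on to \<open>p\<close> without using \<open>e\<close>.\<close>

lemma parent_edge_unique:
  assumes w: "w \<in> V" and e: "e \<in> E" "v \<in> e" "p \<in> e" "d w p < d w v"
    and f: "f \<in> E" "v \<in> f" "q \<in> f" "d w q < d w v"
  shows "e = f"
proof (rule ccontr)
  assume ef: "e \<noteq> f"
  \<comment> \<open>Distances from \<open>w\<close> vary by at most 1 within an edge, so nothing in
    \<open>e\<close> is closer to \<open>w\<close> than \<open>p\<close> or
    \<open>q\<close>.\<close>
  have far: "d w v \<le> d w u + 1" if "u \<in> e" for u
  proof (cases "u = v")
    case False
    then have "(u, v) \<in> adj" using that e by (intro adjrI[of e]) auto
    then show ?thesis using hdist_triangle_adj[OF w] that edge_subset[OF e(1)] by blast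
  qed simp
  have "(p, w) \<in> (adjr (E - {e}))\<^sup>*"
  proof (rule walk_to_root_avoiding[OF w])
    show "d w p \<le> d w u" if "u \<in> e" for u using far[OF that] e(4) by simp
  qed (use e edge_subset in blast)
  moreover have "(q, w) \<in> (adjr (E - {e}))\<^sup>*"
  proof (rule walk_to_root_avoiding[OF w])
    show "d w q \<le> d w u" if "u \<in> e" for u using far[OF that] f(4) by simp
  qed (use f edge_subset in blast)
  moreover have "(v, q) \<in> adjr (E - {e})" using f ef by (intro adjrI[of f]) auto
  ultimately have "(v, p) \<in> (adjr (E - {e}))\<^sup>*"
    by (meson adjr_rtrancl_sym rtrancl_trans r_into_rtrancl)
  moreover have "v \<noteq> p" using e(4) by auto
  ultimately show False using edge_separates[OF e(1,2,3)] by blast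
qed

text \<open>Root \<open>G\<close> at \<open>w\<close> and remove from each edge its vertex nearest
  to \<open>w\<close>. The remaining sets, of size \<open>k - 1\<close>, partition the vertices
  other than \<open>w\<close>: a closer neighbour yields an edge whose remaining set contains a
  given vertex, and uniqueness of the parent edge yields disjointness.\<close>

lemma card_verts_uniform:
  assumes u: "uniform k G" and k: "k \<ge> 1"
  shows "card V = 1 + (k - 1) * card E"
proof -
  obtain w where w: "w \<in> V" using verts_nonempty by blast
  define c where "c e = (SOME p. p \<in> e \<and> (\<forall>u\<in>e. d w p \<le> d w u))" for e
  have c: "c e \<in> e \<and> (\<forall>u\<in>e. d w (c e) \<le> d w u)" if "e \<in> E" for e
  proof -
    have "e \<noteq> {}" "finite e" using that hyp finite_edge by (auto simp: hypergraph_def)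
    then have "\<exists>p. p \<in> e \<and> (\<forall>u\<in>e. d w p \<le> d w u)"
      using arg_min_if_finite[of e "d w"] by (metis not_less)
    then show ?thesis unfolding c_def by (rule someI_ex)
  qed
  have less: "d w (c e) < d w v" if "e \<in> E" "v \<in> e - {c e}" for e v
  proof (rule ccontr)
    assume "\<not> ?thesis"
    then have "\<And>u. u \<in> e \<Longrightarrow> d w v \<le> d w u" using c[OF that(1)] by force
    then have "v = c e" using nearest_unique[OF w that(1)] c[OF that(1)] that(2) by blast
    then show False using that by blast
  qed
  have "V - {w} = (\<Union>e\<in>E. e - {c e})"
  proof (intro equalityI subsetI)
    fix v assume v: "v \<in> V - {w}"
    then obtain p where p: "(v, p) \<in> adj" "d w v = Suc (d w p)"
      using ex_closer_neighbour[OF w] by blast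
    then obtain e where e: "e \<in> E" "v \<in> e" "p \<in> e" by (auto simp: adjr_def)
    then have "v \<noteq> c e" using c[OF e(1)] p(2) by (metis Suc_n_not_le_n)
    then show "v \<in> (\<Union>e\<in>E. e - {c e})" using e by blast
  next
    fix v assume "v \<in> (\<Union>e\<in>E. e - {c e})"
    then obtain e where e: "e \<in> E" "v \<in> e - {c e}" by blast
    then have "v \<noteq> w" using less[OF e] hdist_self[OF w] by auto
    then show "v \<in> V - {w}" using e edge_subset by blast
  qed
  moreover have "card (\<Union>e\<in>E. e - {c e}) = (\<Sum>e\<in>E. card (e - {c e}))"
  proof (rule card_UN_disjoint[OF finite_edges])
    show "\<forall>e\<in>E. finite (e - {c e})" using finite_edge by auto
    show "\<forall>e\<in>E. \<forall>f\<in>E. e \<noteq> f \<longrightarrow> (e - {c e}) \<inter> (f - {c f}) = {}"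
    proof (intro ballI impI)
      fix e f assume ef: "e \<in> E" "f \<in> E" "e \<noteq> f"
      have False if "v \<in> e - {c e}" "v \<in> f - {c f}" for v
        using parent_edge_unique[OF w ef(1) _ _ less[OF ef(1) that(1)] ef(2) _ _ less[OF ef(2) that(2)]]
          that c ef by blast
      then show "(e - {c e}) \<inter> (f - {c f}) = {}" by blast
    qed
  qed
  moreover have "(\<Sum>e\<in>E. card (e - {c e})) = (\<Sum>e\<in>E. k - 1)"
    using u c finite_edge by (intro sum.cong) (auto simp: uniform_def card_Diff_singleton)
  ultimately have "card (V - {w}) = (k - 1) * card E" by simp
  moreover have "card V > 0" using w finite_verts by (auto simp: card_gt_0_iff)
  ultimately show ?thesis using w by (simp add: card_Diff_singleton)
qed

text \<open>If both \<open>z1\<close> and \<open>z2\<close> were within distance 2 of \<open>v\<close>, concatenation would lead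
  from \<open>w\<close> through \<open>z2\<close> and \<open>v\<close> back into \<open>e1\<close> without using \<open>e1\<close>.\<close>

lemma far_neighbour:
  assumes e1: "e1 \<in> E" "w \<in> e1" "z1 \<in> e1" "z1 \<noteq> w"
    and e2: "e2 \<in> E" "w \<in> e2" "z2 \<in> e2" "z2 \<noteq> w" and ne: "e1 \<noteq> e2"
    and v: "v \<in> V" "v \<noteq> w" "(w, v) \<notin> adj"
  shows "d v z1 \<ge> 3 \<or> d v z2 \<ge> 3"
proof (rule ccontr)
  assume "\<not> ?thesis"
  then have le: "d z1 v \<le> 2" "d z2 v \<le> 2"
    using v e1 e2 edge_subset by (auto simp: hdist_commute[of v] subset_iff)
  let ?R = "(adjr (E - {e1}))\<^sup>*"
  have ve1: "v \<notin> e1" using v e1 adjrI[of e1 E w v] by blast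
  \<comment> \<open>An edge through \<open>v\<close> cannot be \<open>e1\<close>, so it survives the
    deletion.\<close>
  have toV: "(y, v) \<in> ?R" if "(y, v) \<in> adj\<^sup>=" for y
    using that ve1 by (auto simp: adjr_def)
  have ne_w: "y \<noteq> w" if "(y, v) \<in> adj\<^sup>=" for y
    using that v by auto
  have not_e1: "x \<notin> e1" if "(w, x) \<in> ?R" "x \<noteq> w" for x
    using edge_separates[OF e1(1,2), of x] that by blast
  \<comment> \<open>Likewise a move with an endpoint outside \<open>e1\<close> uses an edge other
    than \<open>e1\<close>.\<close>
  have step: "(w, y) \<in> ?R" if "(w, x) \<in> ?R" "x \<notin> e1 \<or> y \<notin> e1" "(x, y) \<in> adj\<^sup>=" for x y
  proof (cases "x = y")
    case False
    then have "(x, y) \<in> adjr (E - {e1})" using that(2,3) by (auto simp: adjr_def)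
    then show ?thesis using that(1) by (rule rtrancl_into_rtrancl[rotated])
  qed (use that in auto)
  obtain y2 where y2: "(z2, y2) \<in> adj\<^sup>=" "(y2, v) \<in> adj\<^sup>="
    using relpow_2_cases[OF _ v(1) le(2)] e2 edge_subset by blast
  obtain y1 where y1: "(z1, y1) \<in> adj\<^sup>=" "(y1, v) \<in> adj\<^sup>="
    using relpow_2_cases[OF _ v(1) le(1)] e1 edge_subset by blast
  have "(w, z2) \<in> adjr (E - {e1})" using e2 ne by (intro adjrI[of e2]) auto
  then have z2: "(w, z2) \<in> ?R" by blast
  then have "(w, y2) \<in> ?R" using step y2(1) not_e1 e2(4) by blast
  then have "(w, v) \<in> ?R" using toV[OF y2(2)] by (rule rtrancl_trans)
  then have wy1: "(w, y1) \<in> ?R" using adjr_rtrancl_sym[OF toV[OF y1(2)]] by (rule rtrancl_trans)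
  then have "y1 \<notin> e1" using not_e1 ne_w[OF y1(2)] by blast
  moreover have "(y1, z1) \<in> adj\<^sup>=" using y1(1) sym_adjr[of E] by (auto simp: sym_def)
  ultimately have "(w, z1) \<in> ?R" using step[OF wy1] by blast
  then show False using not_e1 e1 by blast
qed

end

section \<open>The spectral radius of the hyperstar\<close>

text \<open>Eigenvectors are functions on the vertices here, which frees the later arguments from
  the numbering picked by \<open>SOME\<close> in \<open>distance_spectral_radius\<close>.\<close>

definition dist_eigenvalue :: "'a hypergraph \<Rightarrow> real \<Rightarrow> bool" where
  "dist_eigenvalue G c \<longleftrightarrow>
    (\<exists>x. (\<exists>v\<in>verts G. x v \<noteq> 0) \<and>
         (\<forall>u\<in>verts G. (\<Sum>v\<in>verts G. real (hdist G u v) * x v) = c * x u))"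

lemma distance_spectral_radius_eq_Max:
  assumes "finite (verts G)"
  shows "finite (Collect (dist_eigenvalue G))"
    and "distance_spectral_radius G = Max (Collect (dist_eigenvalue G))"
proof -
  define f where "f = (SOME f. bij_betw f {0..<card (verts G)} (verts G))"
  have f: "bij_betw f {0..<card (verts G)} (verts G)"
    unfolding f_def using ex_bij_betw_nat_finite[OF assms] by (rule someI_ex)
  have sp: "spectrum (distance_matrix G f) = Collect (dist_eigenvalue G)"
    by (intro Set.set_eqI)
      (simp only: spectrum_def mem_Collect_eq eigenvalue_distance_matrix_iff[OF f] dist_eigenvalue_def)
  have "distance_matrix G f \<in> carrier_mat (card (verts G)) (card (verts G))"
    by (simp add: distance_matrix_def)
  from card_finite_spectrum(1)[OF this] show "finite (Collect (dist_eigenvalue G))"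
    unfolding sp .
  show "distance_spectral_radius G = Max (Collect (dist_eigenvalue G))"
    unfolding distance_spectral_radius_def f_def[symmetric] sp ..
qed

lemma dist_eigenvalue_le:
  "finite (verts G) \<Longrightarrow> dist_eigenvalue G c \<Longrightarrow> c \<le> distance_spectral_radius G"
  by (simp add: distance_spectral_radius_eq_Max)

lemma distance_spectral_radius_eqI:
  assumes "finite (verts G)" "dist_eigenvalue G l" "\<And>c. dist_eigenvalue G c \<Longrightarrow> c \<le> l"
  shows "distance_spectral_radius G = l"
  using assms by (auto simp: distance_spectral_radius_eq_Max intro: Max_eqI)

section \<open>Invariance under isomorphism\<close>

lemma hyperiso_sym:
  assumes G: "hypergraph G" and iso: "hyperiso G H"
  shows "hyperiso H G"
proof -
  obtain f where f: "bij_betw f (verts G) (verts H)" and E: "edges H = (\<lambda>e. f ` e) ` edges G"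
    using iso by (auto simp: hyperiso_def)
  let ?g = "inv_into (verts G) f"
  have "?g ` (f ` e) = e" if "e \<in> edges G" for e
    using that G bij_betw_imp_inj_on[OF f]
    by (intro inv_into_image_cancel) (auto simp: hypergraph_def)
  then have "edges G = (\<lambda>e. ?g ` e) ` edges H"
    unfolding E image_image by simp
  then show ?thesis
    unfolding hyperiso_def using bij_betw_inv_into[OF f] by blast
qed

lemma relpow_adjr_image:
  assumes G: "hypergraph G" and f: "inj_on f (verts G)" and E: "edges H = (\<lambda>e. f ` e) ` edges G"
    and uv: "(u, v) \<in> adjr (edges G) ^^ n"
  shows "(f u, f v) \<in> adjr (edges H) ^^ n"
  using uv
proof (induction n arbitrary: v)
  case (Suc n)
  then obtain z where z: "(u, z) \<in> adjr (edges G) ^^ n" "(z, v) \<in> adjr (edges G)" by auto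
  obtain e where e: "e \<in> edges G" "z \<in> e" "v \<in> e" "z \<noteq> v" using z(2) by (auto simp: adjr_def)
  have "f z \<noteq> f v"
    using adjr_verts[OF G z(2)] inj_onD[OF f] e(4) by blast
  then have "(f z, f v) \<in> adjr (edges H)"
    using e E by (intro adjrI[of "f ` e"]) auto
  then show ?case by (rule relpow_Suc_I[OF Suc.IH[OF z(1)]])
qed auto

text \<open>Walks are carried forward along \<open>f\<close> and back along its inverse, so the same
  walk lengths occur on both sides.\<close>

lemma hdist_iso:
  assumes G: "hypergraph G" and H: "hypergraph H"
    and f: "bij_betw f (verts G) (verts H)" and E: "edges H = (\<lambda>e. f ` e) ` edges G"
    and u: "u \<in> verts G" and v: "v \<in> verts G"
  shows "hdist H (f u) (f v) = hdist G u v"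
proof -
  let ?g = "inv_into (verts G) f"
  have inj: "inj_on f (verts G)" using f by (rule bij_betw_imp_inj_on)
  have "?g ` (f ` e) = e" if "e \<in> edges G" for e
    using that G inj by (intro inv_into_image_cancel) (auto simp: hypergraph_def)
  then have E': "edges G = (\<lambda>e. ?g ` e) ` edges H"
    unfolding E image_image by simp
  have inj': "inj_on ?g (verts H)" using bij_betw_inv_into[OF f] by (rule bij_betw_imp_inj_on)
  have "(f u, f v) \<in> adjr (edges H) ^^ n \<longleftrightarrow> (u, v) \<in> adjr (edges G) ^^ n" for n
    using relpow_adjr_image[OF G inj E, of u v n] relpow_adjr_image[OF H inj' E', of "f u" "f v" n]
      u v inj by auto
  then show ?thesis
    using u f by (simp add: hdist_eq_Least[OF G] hdist_eq_Least[OF H] bij_betwE)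
qed

lemma dist_eigenvalue_iso:
  assumes G: "hypergraph G" and H: "hypergraph H" and iso: "hyperiso G H"
    and c: "dist_eigenvalue H c"
  shows "dist_eigenvalue G c"
proof -
  obtain f where f: "bij_betw f (verts G) (verts H)" and E: "edges H = (\<lambda>e. f ` e) ` edges G"
    using iso by (auto simp: hyperiso_def)
  obtain x where x: "\<exists>v\<in>verts H. x v \<noteq> 0"
    "\<And>u. u \<in> verts H \<Longrightarrow> (\<Sum>v\<in>verts H. real (hdist H u v) * x v) = c * x u"
    using c by (auto simp: dist_eigenvalue_def)
  have "(\<Sum>v\<in>verts G. real (hdist G u v) * x (f v)) = c * x (f u)" if u: "u \<in> verts G" for u
  proof -
    have "(\<Sum>v\<in>verts G. real (hdist G u v) * x (f v))
        = (\<Sum>v\<in>verts G. real (hdist H (f u) (f v)) * x (f v))"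
      using hdist_iso[OF G H f E u] by (intro sum.cong) auto
    also have "\<dots> = (\<Sum>v\<in>verts H. real (hdist H (f u) v) * x v)"
      by (rule sum.reindex_bij_betw[OF f])
    also have "\<dots> = c * x (f u)" using u f by (intro x(2)) (auto simp: bij_betwE)
    finally show ?thesis .
  qed
  moreover have "\<exists>v\<in>verts G. x (f v) \<noteq> 0"
    using x(1) unfolding bij_betw_imp_surj_on[OF f, symmetric] by blast
  ultimately show ?thesis
    unfolding dist_eigenvalue_def by (intro exI[of _ "\<lambda>v. x (f v)"]) blast
qed

lemma distance_spectral_radius_iso:
  assumes G: "hypergraph G" and H: "hypergraph H" and iso: "hyperiso G H"
  shows "distance_spectral_radius G = distance_spectral_radius H"
proof -
  have "Collect (dist_eigenvalue G) = Collect (dist_eigenvalue H)"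
    using dist_eigenvalue_iso[OF G H iso] dist_eigenvalue_iso[OF H G hyperiso_sym[OF G iso]] by blast
  then show ?thesis
    using G H by (simp add: distance_spectral_radius_eq_Max hypergraph_def)
qed

section \<open>Distances and spectral radius of the hyperstar\<close>

lemma verts_hyperstar:
  assumes "k \<ge> 2"
  shows "verts (hyperstar (1 + (k - 1) * m) k) = insert None (Some ` ({..<m} \<times> {..<k - 1}))"
  using assms by (auto simp: hyperstar_def Let_def)

lemma edges_hyperstar:
  assumes "k \<ge> 2"
  shows "edges (hyperstar (1 + (k - 1) * m) k)
    = (\<lambda>i. insert None ((\<lambda>j. Some (i, j)) ` {..<k - 1})) ` {..<m}"
  using assms by (auto simp: hyperstar_def Let_def)

lemma hypergraph_hyperstar:
  assumes "k \<ge> 2"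
  shows "hypergraph (hyperstar (1 + (k - 1) * m) k)"
  unfolding hypergraph_def verts_hyperstar[OF assms] edges_hyperstar[OF assms] by auto

lemma adjr_hyperstar:
  fixes m :: nat
  assumes k: "k \<ge> 2"
  defines "A \<equiv> adjr (edges (hyperstar (1 + (k - 1) * m) k))"
  shows "(None, Some (i, j)) \<in> A \<longleftrightarrow> i < m \<and> j < k - 1"
    and "(Some (i, j), None) \<in> A \<longleftrightarrow> i < m \<and> j < k - 1"
    and "(Some (i, j), Some (i', j')) \<in> A \<longleftrightarrow>
      i < m \<and> j < k - 1 \<and> i' = i \<and> j' < k - 1 \<and> j \<noteq> j'"
  unfolding A_def adjr_def edges_hyperstar[OF k] by auto

lemma conn_hyperstar:
  fixes m :: nat
  assumes k: "k \<ge> 2"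
  shows "conn_hypergraph (hyperstar (1 + (k - 1) * m) k)" (is "conn_hypergraph ?S")
proof
  show hyp: "hypergraph ?S" by (rule hypergraph_hyperstar[OF k])
  have None: "(None, v) \<in> (adjr (edges ?S))\<^sup>*" if "v \<in> verts ?S" for v
    using that adjr_hyperstar(1)[OF k, of _ _ m] unfolding verts_hyperstar[OF k] by auto
  have "\<exists>vs es. hpath ?S u vs es v" if "u \<in> verts ?S" "v \<in> verts ?S" for u v
    using rtrancl_imp_hpath[OF hyp subset_refl that(1)
        rtrancl_trans[OF adjr_rtrancl_sym[OF None[OF that(1)]] None[OF that(2)]]] by blast
  then show "hconnected ?S" by (simp add: hconnected_def)
qed

lemma hdist_hyperstar:
  fixes m :: nat
  assumes k: "k \<ge> 2"
  defines "D \<equiv> hdist (hyperstar (1 + (k - 1) * m) k)"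
  assumes ij: "i < m" "j < k - 1"
  shows "D None None = 0" "D None (Some (i, j)) = 1" "D (Some (i, j)) None = 1"
    and "i' < m \<Longrightarrow> j' < k - 1 \<Longrightarrow>
      D (Some (i, j)) (Some (i', j')) = (if i' = i then if j' = j then 0 else 1 else 2)"
proof -
  let ?S = "hyperstar (1 + (k - 1) * m) k"
  interpret S: conn_hypergraph ?S by (rule conn_hyperstar[OF k])
  have None: "None \<in> verts ?S" unfolding verts_hyperstar[OF k] by simp
  have V: "Some (a, b) \<in> verts ?S" if "a < m" "b < k - 1" for a b
    using that unfolding verts_hyperstar[OF k] by blast
  note adj = adjr_hyperstar[OF k, where m = m]
  note v = V[OF ij]
  show "D None None = 0" unfolding D_def by (rule S.hdist_self[OF None])
  show "D None (Some (i, j)) = 1" unfolding D_def S.hdist_eq_1[OF None v] adj using ij ..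
  show 1: "D (Some (i, j)) None = 1" unfolding D_def S.hdist_eq_1[OF v None] adj using ij ..
  show "D (Some (i, j)) (Some (i', j')) = (if i' = i then if j' = j then 0 else 1 else 2)"
    if ij': "i' < m" "j' < k - 1"
  proof -
    note v' = V[OF ij']
    have eq0: "D (Some (i, j)) (Some (i', j')) = 0 \<longleftrightarrow> i = i' \<and> j = j'"
      unfolding D_def S.hdist_eq_0[OF v v'] by simp
    have eq1: "D (Some (i, j)) (Some (i', j')) = 1 \<longleftrightarrow> i' = i \<and> j \<noteq> j'"
      unfolding D_def S.hdist_eq_1[OF v v'] adj using ij ij' by blast
    \<comment> \<open>A two-step route through the centre bounds the distance by 2; the criteria for
      distances 0 and 1 decide the rest.\<close>
    have "(None, Some (i', j')) \<in> adjr (edges ?S)" unfolding adj using ij' ..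
    from S.hdist_triangle_adj[OF v None this] 1
    have le2: "D (Some (i, j)) (Some (i', j')) \<le> 2" unfolding D_def by linarith
    have q: "q = (if i' = i then if j' = j then 0 else 1 else 2)"
      if "q = 0 \<longleftrightarrow> i = i' \<and> j = j'" "q = 1 \<longleftrightarrow> i' = i \<and> j \<noteq> j'" "q \<le> 2" for q :: nat
      using that by (cases "i' = i"; cases "j' = j") auto
    show ?thesis by (rule q[OF eq0 eq1 le2])
  qed
qed

text \<open>The Perron vector of the hyperstar is \<open>N\<close> at the centre and \<open>star_radius\<close> elsewhere, where
  \<open>N = (k - 1) m\<close>, and \<open>star_row\<close> is the sum of the distances of a vertex other than the centre
  to all such vertices.\<close>

definition star_row :: "nat \<Rightarrow> nat \<Rightarrow> real" where
  "star_row k m = 2 * real ((k - 1) * m) - real k"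

definition star_radius :: "nat \<Rightarrow> nat \<Rightarrow> real" where
  "star_radius k m = (star_row k m + sqrt ((star_row k m)\<^sup>2 + 4 * real ((k - 1) * m))) / 2"

text \<open>In the eigenvalue equation for this vector, the row of the centre makes the eigenvalue
  equal to the common value at the other vertices. Each other row then reads as this quadratic
  equation, whose positive root is \<open>star_radius\<close>.\<close>

lemma star_radius:
  assumes "k \<ge> 2" "m \<ge> 1"
  shows "star_radius k m > 0"
    and "(star_radius k m)\<^sup>2 = star_row k m * star_radius k m + real ((k - 1) * m)"
proof -
  define c N where "c = star_row k m" and "N = real ((k - 1) * m)"
  define s where "s = sqrt (c\<^sup>2 + 4 * N)"
  have l: "star_radius k m = (c + s) / 2" by (simp add: star_radius_def c_def N_def s_def)
  have N: "N > 0" using assms by (simp add: N_def)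
  have "\<bar>c\<bar> < s" unfolding s_def using N by (intro real_less_rsqrt) simp
  then have "c + s > 0" by linarith
  then show "star_radius k m > 0" unfolding l by simp
  have "s\<^sup>2 = c\<^sup>2 + 4 * N" unfolding s_def using N by simp
  then show "(star_radius k m)\<^sup>2 = star_row k m * star_radius k m + real ((k - 1) * m)"
    unfolding l c_def[symmetric] N_def[symmetric] by (simp add: field_simps power2_eq_square)
qed

lemma sum_star_row:
  fixes i j k m :: nat
  assumes "i < m" "j < k - 1"
  shows "(\<Sum>i'<m. \<Sum>j'<k-1. (if i' = i then if j' = j then 0 else 1 else 2)) = star_row k m"
proof -
  \<comment> \<open>A block not containing the chosen vertex contributes 2 per vertex. Its own block
    contributes one 0 and \<open>k - 2\<close> ones, which is \<open>k\<close> less than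
    \<open>2 * (k - 1)\<close>.\<close>
  have "(\<Sum>j'<k-1. (if i' = i then if j' = j then 0 else 1 else 2))
      = 2 * real (k - 1) - (if i' = i then real k else 0)" for i' :: nat
  proof -
    have "(\<Sum>j'<k-1. (if j' = j then 0 else 1)) = (\<Sum>j'<k-1. 1 - (if j' = j then 1 else 0 :: real))"
      by (intro sum.cong) auto
    also have "\<dots> = real (k - 1) - 1" using assms(2) by (simp add: sum_subtractf)
    finally show ?thesis using assms(2) by (auto simp: of_nat_diff)
  qed
  then show ?thesis
    using assms(1) by (simp add: sum_subtractf star_row_def mult_ac)
qed

text \<open>The vector \<open>x\<close> is a positive eigenvector, so
  \<open>eigenvalue_le_positive\<close> makes its eigenvalue the largest.\<close>

lemma distance_spectral_radius_hyperstar: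
  fixes m :: nat
  assumes k: "k \<ge> 2" and m: "m \<ge> 1"
  shows "distance_spectral_radius (hyperstar (1 + (k - 1) * m) k) = star_radius k m"
proof -
  let ?S = "hyperstar (1 + (k - 1) * m) k"
  interpret S: conn_hypergraph ?S by (rule conn_hyperstar[OF k])
  define l N where "l = star_radius k m" and "N = real ((k - 1) * m)"
  have l: "l > 0" "l\<^sup>2 = star_row k m * l + N"
    using star_radius[OF k m] by (simp_all add: l_def N_def)
  have N: "N > 0" using k m by (simp add: N_def)
  have sumV: "(\<Sum>v\<in>verts ?S. g v) = g None + (\<Sum>i<m. \<Sum>j<k-1. g (Some (i, j)))"
    for g :: "(nat \<times> nat) option \<Rightarrow> real"
    unfolding verts_hyperstar[OF k]
    by (subst sum.insert) (auto simp: sum.reindex sum.cartesian_product)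
  define x :: "(nat \<times> nat) option \<Rightarrow> real" where "x v = (if v = None then N else l)" for v
  have ev: "(\<Sum>v\<in>verts ?S. real (hdist ?S u v) * x v) = l * x u" if u: "u \<in> verts ?S" for u
  proof (cases u)
    case None
    have "(\<Sum>i<m. \<Sum>j<k-1. real (hdist ?S None (Some (i, j))) * x (Some (i, j)))
        = (\<Sum>i<m. \<Sum>j<k-1. l)"
      using hdist_hyperstar(2)[OF k] by (intro sum.cong) (auto simp: x_def)
    moreover have "real (hdist ?S None None) = 0"
      using S.hdist_self u unfolding None by simp
    ultimately show ?thesis unfolding None sumV by (simp add: x_def N_def)
  next
    case (Some p)
    obtain i j where p: "p = (i, j)" by (cases p)
    then have ij: "i < m" "j < k - 1" using u Some unfolding verts_hyperstar[OF k] by auto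
    have "(\<Sum>i'<m. \<Sum>j'<k-1. real (hdist ?S u (Some (i', j'))) * x (Some (i', j')))
        = (\<Sum>i'<m. \<Sum>j'<k-1. (if i' = i then if j' = j then 0 else 1 else 2) * l)"
      unfolding Some p using hdist_hyperstar(4)[OF k ij] by (intro sum.cong) (auto simp: x_def)
    also have "\<dots> = star_row k m * l"
      unfolding sum_star_row[OF ij, symmetric] by (simp only: sum_distrib_right)
    finally have "(\<Sum>v\<in>verts ?S. real (hdist ?S u v) * x v) = N + star_row k m * l"
      unfolding sumV using hdist_hyperstar(3)[OF k ij] by (simp add: Some p x_def)
    then show ?thesis using l(2) by (simp add: x_def Some power2_eq_square)
  qed
  show ?thesis
    unfolding l_def[symmetric]
  proof (rule distance_spectral_radius_eqI[OF S.finite_verts])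
    have "None \<in> verts ?S" unfolding verts_hyperstar[OF k] by simp
    then show "dist_eigenvalue ?S l"
      unfolding dist_eigenvalue_def using ev N by (intro exI[of _ x]) (auto simp: x_def)
    show "c \<le> l" if "dist_eigenvalue ?S c" for c
    proof -
      obtain y where y: "\<exists>v\<in>verts ?S. y v \<noteq> 0"
        "\<And>u. u \<in> verts ?S \<Longrightarrow> (\<Sum>v\<in>verts ?S. real (hdist ?S u v) * y v) = c * y u"
        using \<open>dist_eigenvalue ?S c\<close> unfolding dist_eigenvalue_def by blast
      show ?thesis
      proof (rule eigenvalue_le_positive[OF S.finite_verts _ _ _ ev y])
        show "real (hdist ?S u v) = real (hdist ?S v u)" if "u \<in> verts ?S" "v \<in> verts ?S" for u v
          using S.hdist_commute[OF that] by simp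
      qed (use l N in \<open>auto simp: x_def\<close>)
    qed
  qed
qed

section \<open>Comparison with the hyperstar\<close>

lemma card_off_diagonal:
  assumes "finite A"
  shows "card (A \<times> A - Id) = card A * card A - card A"
proof -
  have "A \<times> A - Id = A \<times> A - (\<lambda>x. (x, x)) ` A" by auto
  also have "card \<dots> = card (A \<times> A) - card ((\<lambda>x. (x, x)) ` A)"
    by (rule card_Diff_subset) (use assms in auto)
  also have "card ((\<lambda>x. (x, x)) ` A) = card A" by (rule card_image) (simp add: inj_on_def)
  finally show ?thesis by (simp add: card_cartesian_product)
qed

context hypertree_loc
begin

text \<open>A union bound over the edges suffices, since adjacent pairs only have to be bounded from
  above.\<close>

lemma card_adj_le:
  assumes "uniform k G"
  shows "card adj \<le> card E * (k * (k - 1))"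
proof -
  have adj: "adj = (\<Union>e\<in>E. e \<times> e - Id)" by (auto simp: adjr_def)
  have "card adj \<le> (\<Sum>e\<in>E. card (e \<times> e - Id))"
    unfolding adj by (rule card_UN_le[OF finite_edges])
  also have "\<dots> = (\<Sum>e\<in>E. k * (k - 1))"
  proof (rule sum.cong)
    fix e assume e: "e \<in> E"
    have "card e = k" using assms e by (simp add: uniform_def)
    then show "card (e \<times> e - Id) = k * (k - 1)"
      using card_off_diagonal[OF finite_edge[OF e]] by (simp add: diff_mult_distrib2)
  qed simp
  finally show ?thesis by simp
qed

text \<open>Compared with a hyperstar centred at \<open>w\<close>, every vertex not adjacent to \<open>w\<close> yields two
  more adjacent ordered pairs away from \<open>w\<close>; these are compensated by two ordered pairs at
  distance at least 3, provided that \<open>w\<close> lies in two edges.\<close>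

lemma sum_hdist_away_ge:
  assumes u: "uniform k G" and k: "k \<ge> 2"
    and e1: "e1 \<in> E" "w \<in> e1" and e2: "e2 \<in> E" "w \<in> e2" and ne: "e1 \<noteq> e2"
  defines "N \<equiv> (k - 1) * card E"
  shows "(\<Sum>x\<in>V - {w}. \<Sum>y\<in>V - {w}. d x y) + N * k \<ge> 2 * N * N"
proof -
  define W where "W = V - {w}"
  have w: "w \<in> V" using e1 edge_subset by blast
  have fW: "finite W" using finite_verts by (simp add: W_def)
  have cW: "card W = N"
    using card_verts_uniform[OF u] k w finite_verts by (simp add: W_def N_def card_Diff_singleton)
  \<comment> \<open>\<open>B\<close> and \<open>C\<close> split the vertices other than
    \<open>w\<close> into neighbours and non-neighbours of \<open>w\<close>. \<open>A\<close>,
    \<open>O'\<close> and \<open>F\<close> collect the adjacent, the distinct and the far ordered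
    pairs away from \<open>w\<close>.\<close>
  define B where "B = {v \<in> W. (w, v) \<in> adj}"
  define C where "C = {v \<in> W. (w, v) \<notin> adj}"
  define A where "A = {p \<in> W \<times> W. p \<in> adj}"
  define O' where "O' = {p \<in> W \<times> W. fst p \<noteq> snd p}"
  define F where "F = {p \<in> W \<times> W. d (fst p) (snd p) \<ge> 3}"
  have fin: "finite B" "finite C" "finite A" "finite O'" "finite F"
    using fW by (simp_all add: B_def C_def A_def O'_def F_def)
  have BC: "card B + card C = N"
  proof -
    have "card (B \<union> C) = card B + card C"
      by (rule card_Un_disjoint) (use fin in \<open>auto simp: B_def C_def\<close>)
    moreover have "B \<union> C = W" by (auto simp: B_def C_def)
    ultimately show ?thesis using cW by simp
  qed
  \<comment> \<open>Besides \<open>A\<close>, the adjacency relation contains two ordered pairs with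
    \<open>w\<close> for each vertex of \<open>B\<close>.\<close>
  have "card A + 2 * card B \<le> card adj"
  proof -
    have "card (A \<union> (Pair w ` B \<union> (\<lambda>v. (v, w)) ` B)) = card A + card (Pair w ` B \<union> (\<lambda>v. (v, w)) ` B)"
      by (rule card_Un_disjoint) (use fin in \<open>auto simp: A_def W_def\<close>)
    also have "card (Pair w ` B \<union> (\<lambda>v. (v, w)) ` B) = card (Pair w ` B) + card ((\<lambda>v. (v, w)) ` B)"
      by (rule card_Un_disjoint) (use fin in \<open>auto simp: B_def W_def\<close>)
    also have "card (Pair w ` B) = card B" by (rule card_image) (simp add: inj_on_def)
    also have "card ((\<lambda>v. (v, w)) ` B) = card B" by (rule card_image) (simp add: inj_on_def)
    finally have "card A + 2 * card B = card (A \<union> (Pair w ` B \<union> (\<lambda>v. (v, w)) ` B))" by simp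
    also have "\<dots> \<le> card adj"
    proof (rule card_mono)
      have "adj \<subseteq> V \<times> V" using adjr_verts[OF hyp] by auto
      then show "finite adj" using finite_verts by (meson finite_SigmaI finite_subset)
      show "A \<union> (Pair w ` B \<union> (\<lambda>v. (v, w)) ` B) \<subseteq> adj"
        using symD[OF sym_adjr[of E]] by (auto simp: A_def B_def)
    qed
    finally show ?thesis .
  qed
  also have "\<dots> \<le> N * k"
    using card_adj_le[OF u] by (simp add: N_def mult_ac)
  finally have A: "card A + 2 * card B \<le> N * k" .
  have "\<forall>v\<in>C. \<exists>z. z \<in> B \<and> d v z \<ge> 3"
  proof
    fix v assume v: "v \<in> C"
    have other: "\<exists>z. z \<in> e \<and> z \<noteq> w" if "e \<in> E" for e
    proof -
      have "card e = k" using u that by (simp add: uniform_def)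
      then have "\<not> e \<subseteq> {w}" using k card_mono[of "{w}" e] by auto
      then show ?thesis by blast
    qed
    obtain z1 where z1: "z1 \<in> e1" "z1 \<noteq> w" using other[OF e1(1)] by blast
    obtain z2 where z2: "z2 \<in> e2" "z2 \<noteq> w" using other[OF e2(1)] by blast
    have "z1 \<in> B" "z2 \<in> B"
      using z1 z2 e1 e2 edge_subset adjrI[of _ E w] unfolding B_def W_def by blast+
    moreover have "d v z1 \<ge> 3 \<or> d v z2 \<ge> 3"
      by (rule far_neighbour[OF e1 z1 e2 z2 ne]) (use v in \<open>auto simp: C_def W_def\<close>)
    ultimately show "\<exists>z. z \<in> B \<and> d v z \<ge> 3" by blast
  qed
  then obtain g where g: "\<And>v. v \<in> C \<Longrightarrow> g v \<in> B \<and> d v (g v) \<ge> 3" by metis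
  have F: "2 * card C \<le> card F"
  proof -
    have CB: "C \<inter> B = {}" "C \<subseteq> W" "B \<subseteq> W" "C \<subseteq> V" "B \<subseteq> V" by (auto simp: B_def C_def W_def)
    have "card ((\<lambda>v. (v, g v)) ` C \<union> (\<lambda>v. (g v, v)) ` C)
        = card ((\<lambda>v. (v, g v)) ` C) + card ((\<lambda>v. (g v, v)) ` C)"
      by (rule card_Un_disjoint) (use fin g CB in auto)
    also have "card ((\<lambda>v. (v, g v)) ` C) = card C" by (rule card_image) (simp add: inj_on_def)
    also have "card ((\<lambda>v. (g v, v)) ` C) = card C" by (rule card_image) (simp add: inj_on_def)
    finally have "2 * card C = card ((\<lambda>v. (v, g v)) ` C \<union> (\<lambda>v. (g v, v)) ` C)" by simp
    also have "\<dots> \<le> card F"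
    proof (rule card_mono[OF fin(5)], intro Un_least image_subsetI)
      fix v assume v: "v \<in> C"
      have "d (g v) v = d v (g v)" using g[OF v] v CB by (intro hdist_commute) auto
      then show "(v, g v) \<in> F" "(g v, v) \<in> F" using g[OF v] v CB by (auto simp: F_def)
    qed
    finally show ?thesis .
  qed
  have O': "card O' = N * N - N"
  proof -
    have "O' = W \<times> W - Id" by (auto simp: O'_def)
    then show ?thesis using card_off_diagonal[OF fW] cW by simp
  qed
  have ind: "(\<Sum>p\<in>W \<times> W. if P p then 1 else 0) = card {p \<in> W \<times> W. P p}" for P :: "'a \<times> 'a \<Rightarrow> bool"
    using fW by (simp add: sum.If_cases Int_def)
  \<comment> \<open>Pointwise the distance is at least
    \<open>2 * [distinct] - [adjacent] + [far]\<close>, written without subtraction on natural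
    numbers. After summation the bounds \<open>card A + 2 * card B <= N * k\<close> and
    \<open>2 * card C <= card F\<close> leave exactly the claim, because
    \<open>card B + card C = N\<close>.\<close>
  have "(\<Sum>p\<in>W \<times> W. 2 * (if fst p \<noteq> snd p then 1 else 0) + (if d (fst p) (snd p) \<ge> 3 then 1 else 0))
      \<le> (\<Sum>p\<in>W \<times> W. d (fst p) (snd p) + (if p \<in> adj then 1 else 0))"
  proof (rule sum_mono)
    fix p assume "p \<in> W \<times> W"
    then have p: "fst p \<in> V" "snd p \<in> V" by (auto simp: W_def)
    show "2 * (if fst p \<noteq> snd p then 1 else 0) + (if d (fst p) (snd p) \<ge> 3 then 1 else 0)
        \<le> d (fst p) (snd p) + (if p \<in> adj then 1 else 0)"
      using hdist_eq_0[OF p] hdist_eq_1[OF p] by simp linarith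
  qed
  then have "2 * card O' + card F \<le> (\<Sum>p\<in>W \<times> W. d (fst p) (snd p)) + card A"
    unfolding sum.distrib sum_distrib_left[symmetric] ind O'_def F_def A_def by simp
  moreover have "(\<Sum>p\<in>W \<times> W. d (fst p) (snd p)) = (\<Sum>x\<in>W. \<Sum>y\<in>W. d x y)"
    by (simp add: sum.cartesian_product case_prod_beta)
  \<comment> \<open>This makes the truncated subtraction in \<open>card O'\<close> exact.\<close>
  moreover have "N \<le> N * N" by simp
  ultimately show ?thesis
    using A F O' BC unfolding W_def[symmetric] by (simp add: mult.assoc)
qed

text \<open>Strictness comes from the row of \<open>w\<close>, where \<open>v0\<close> has distance
  at least 2; the pairs away from \<open>w\<close> contribute at least as much as in the
  hyperstar.\<close>

lemma dist_radius_gt_star: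
  assumes u: "uniform k G" and k: "k \<ge> 2"
    and e1: "e1 \<in> E" "w \<in> e1" and e2: "e2 \<in> E" "w \<in> e2" and ne: "e1 \<noteq> e2"
    and v0: "v0 \<in> V" "v0 \<noteq> w" "(w, v0) \<notin> adj"
  shows "distance_spectral_radius G > star_radius k (card E)"
proof -
  define W where "W = V - {w}"
  have w: "w \<in> V" using e1 edge_subset by blast
  have fW: "finite W" and V: "V = insert w W" and wW: "w \<notin> W"
    using finite_verts w by (auto simp: W_def)
  have m: "card E \<ge> 1" using e1 finite_edges by (simp add: Suc_le_eq card_gt_0_iff) blast
  define s N where "s = star_radius k (card E)" and "N = (k - 1) * card E"
  have N: "real N > 0" using m k by (simp add: N_def)
  have s: "s > 0" "s\<^sup>2 = (2 * real N - real k) * s + real N"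
    using star_radius[OF k m] by (simp_all add: s_def N_def star_row_def)
  have cW: "card W = N"
    using card_verts_uniform[OF u] k w finite_verts by (simp add: W_def N_def card_Diff_singleton)
  define P where "P = (\<Sum>x\<in>W. \<Sum>y\<in>W. d x y)"
  define Q where "Q = (\<Sum>v\<in>W. d w v)"
  have "2 * N * N \<le> P + N * k"
    unfolding P_def W_def N_def by (rule sum_hdist_away_ge[OF u k e1 e2 ne])
  then have P: "real N * (2 * real N - real k) \<le> real P"
    unfolding of_nat_le_iff[symmetric, where 'a = real] by (simp add: algebra_simps)
  have "(\<Sum>v\<in>W. 1) < Q"
    unfolding Q_def
  proof (rule sum_strict_mono_ex1[OF fW])
    have ge: "d w v \<ge> 1" if "v \<in> W" for v
      using hdist_eq_0[OF w, of v] that by (auto simp: W_def Suc_le_eq)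
    then show "\<forall>v\<in>W. 1 \<le> d w v" by blast
    have "d w v0 \<noteq> 1" "v0 \<in> W" using v0 hdist_eq_1[OF w v0(1)] by (auto simp: W_def)
    then show "\<exists>v\<in>W. 1 < d w v" using ge by (intro bexI[of _ v0]) (auto simp: order_less_le)
  qed
  then have Q: "real N < real Q" using cW by simp
  define x where "x v = (if v = w then real N else s)" for v
  have x: "x w = real N" "\<And>v. v \<in> W \<Longrightarrow> x v = s" using wW by (auto simp: x_def)
  \<comment> \<open>\<open>Q\<close> enters twice, through the row and the column of
    \<open>w\<close>; the pairs away from \<open>w\<close> give \<open>P\<close>.\<close>
  have "qform V (\<lambda>u v. real (d u v)) x = (\<Sum>v\<in>W. real (d w v) * (real N * s))
      + (\<Sum>u\<in>W. real (d u w) * (s * real N) + (\<Sum>v\<in>W. real (d u v) * (s * s)))"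
    unfolding qform_def V using fW wW by (simp add: x hdist_self[OF w])
  also have "(\<Sum>u\<in>W. real (d u w) * (s * real N) + (\<Sum>v\<in>W. real (d u v) * (s * s)))
      = (\<Sum>v\<in>W. real (d w v) * (s * real N)) + (\<Sum>u\<in>W. \<Sum>v\<in>W. real (d u v) * (s * s))"
    unfolding sum.distrib using hdist_commute[OF w] by (simp add: W_def)
  finally have qf: "qform V (\<lambda>u v. real (d u v)) x = 2 * real N * s * real Q + s\<^sup>2 * real P"
    by (simp add: Q_def P_def sum_distrib_right[symmetric] power2_eq_square)
  have nx: "(\<Sum>v\<in>V. (x v)\<^sup>2) = (real N)\<^sup>2 + real N * s\<^sup>2"
    unfolding V using fW wW by (simp add: x cW)
  \<comment> \<open>For the hyperstar the same vector is an eigenvector, with \<open>Q = N\<close>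
    and \<open>P = N * (2 * N - k)\<close>. This is its Rayleigh identity, obtained from the
    quadratic equation for \<open>s\<close>.\<close>
  have "s * ((real N)\<^sup>2 + real N * s\<^sup>2)
      = 2 * real N * s * real N + s\<^sup>2 * (real N * (2 * real N - real k))"
  proof -
    have "s * ((real N)\<^sup>2 + real N * s\<^sup>2) = s * (real N)\<^sup>2 + s * real N * ((2 * real N - real k) * s + real N)"
      by (subst s(2)) (simp add: algebra_simps)
    then show ?thesis by (simp add: algebra_simps power2_eq_square)
  qed
  also have "\<dots> < 2 * real N * s * real Q + s\<^sup>2 * real P"
    using Q P N s(1) by (intro add_less_le_mono mult_strict_left_mono mult_left_mono) auto
  finally have lt: "s * (\<Sum>v\<in>V. (x v)\<^sup>2) < qform V (\<lambda>u v. real (d u v)) x"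
    unfolding qf nx .
  obtain l y where ly: "\<exists>v\<in>V. y v \<noteq> 0" "\<forall>u\<in>V. (\<Sum>v\<in>V. real (d u v) * y v) = l * y u"
    and le: "\<And>y. qform V (\<lambda>u v. real (d u v)) y \<le> l * (\<Sum>v\<in>V. (y v)\<^sup>2)"
  proof (rule rayleigh_eigen[OF finite_verts verts_nonempty, where M = "\<lambda>u v. real (d u v)"])
    show "real (d u v) = real (d v u)" if "u \<in> V" "v \<in> V" for u v
      using hdist_commute[OF that] by simp
  qed (rule that)
  have "s * (\<Sum>v\<in>V. (x v)\<^sup>2) < l * (\<Sum>v\<in>V. (x v)\<^sup>2)"
    using lt le[of x] by linarith
  moreover have "(\<Sum>v\<in>V. (x v)\<^sup>2) \<ge> 0" by (simp add: sum_nonneg)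
  ultimately have "s < l" by (meson mult_right_mono not_less)
  moreover have "dist_eigenvalue G l"
    unfolding dist_eigenvalue_def using ly by blast
  then have "l \<le> distance_spectral_radius G" by (rule dist_eigenvalue_le[OF finite_verts])
  ultimately show ?thesis by (simp add: s_def)
qed

text \<open>An edge missing \<open>w\<close> would have two of its vertices joined through
  \<open>w\<close> without it, so all edges contain \<open>w\<close>. As two edges share at most one
  vertex, removing \<open>w\<close> leaves disjoint blocks of size \<open>k - 1\<close>, which the
  enumerations \<open>g\<close> and \<open>h\<close> match with those of the hyperstar.\<close>

lemma universal_vertex_imp_hyperstar:
  assumes u: "uniform k G" and k: "k \<ge> 2" and w: "w \<in> V"
    and univ: "\<And>v. v \<in> V \<Longrightarrow> v \<noteq> w \<Longrightarrow> (w, v) \<in> adj"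
  shows "hyperiso (hyperstar (1 + (k - 1) * card E) k) G"
proof -
  define m where "m = card E"
  have we: "w \<in> e" if e: "e \<in> E" for e
  proof (rule ccontr)
    assume we: "w \<notin> e"
    have walk: "(w, x) \<in> (adjr (E - {e}))\<^sup>*" if "x \<in> e" for x
    proof -
      have "(w, x) \<in> adj" using univ that we edge_subset[OF e] by blast
      then have "(w, x) \<in> adjr (E - {e})" using we by (auto simp: adjr_def)
      then show ?thesis ..
    qed
    have c: "card e = k" using u e by (simp add: uniform_def)
    then obtain x where x: "x \<in> e" using k by fastforce
    have "\<not> e \<subseteq> {x}" using c k card_mono[of "{x}" e] by auto
    then obtain y where y: "y \<in> e" "x \<noteq> y" by blast
    have "(x, y) \<in> (adjr (E - {e}))\<^sup>*"
      using adjr_rtrancl_sym[OF walk[OF x]] walk[OF y(1)] by (rule rtrancl_trans)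
    then show False using edge_separates[OF e x y] by blast
  qed
  obtain g where g: "bij_betw g {..<m} E"
    using ex_bij_betw_nat_finite[OF finite_edges] unfolding m_def lessThan_atLeast0 by blast
  then have gE: "g i \<in> E" if "i < m" for i using that by (auto simp: bij_betw_def)
  have "\<forall>i\<in>{..<m}. \<exists>h. bij_betw h {..<k - 1} (g i - {w})"
  proof
    fix i assume "i \<in> {..<m}"
    then have i: "g i \<in> E" using gE by simp
    then have "card (g i - {w}) = k - 1"
      using u we[OF i] finite_edge[OF i] by (simp add: uniform_def card_Diff_singleton)
    then show "\<exists>h. bij_betw h {..<k - 1} (g i - {w})"
      using ex_bij_betw_nat_finite[of "g i - {w}"] finite_edge[OF i]
      unfolding lessThan_atLeast0 by auto
  qed
  then obtain h where h: "\<And>i. i < m \<Longrightarrow> bij_betw (h i) {..<k - 1} (g i - {w})"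
    by (metis lessThan_iff)
  have him: "h i ` {..<k - 1} = g i - {w}" if "i < m" for i
    using h[OF that] by (simp add: bij_betw_def)
  have hin: "h i j \<in> g i" "h i j \<noteq> w" if "i < m" "j < k - 1" for i j
    using him[OF that(1)] that(2) by blast+
  define F where "F p = (case p of None \<Rightarrow> w | Some (i, j) \<Rightarrow> h i j)" for p
  have F: "F None = w" "F (Some (i, j)) = h i j" for i j by (simp_all add: F_def)
  let ?S = "hyperstar (1 + (k - 1) * m) k"
  note SV = verts_hyperstar[OF k, of m] and SE = edges_hyperstar[OF k, of m]
  have hinj: "i = i' \<and> j = j'"
    if ij: "i < m" "j < k - 1" "i' < m" "j' < k - 1" and eq: "h i j = h i' j'" for i j i' j'
  proof -
    have "g i = g i'"
    proof (rule ccontr)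
      assume "g i \<noteq> g i'"
      then have "h i j = w"
        using edges_Int[OF gE[OF ij(1)] gE[OF ij(3)]] hin[OF ij(1,2)] hin[OF ij(3,4)] eq we gE ij
        by metis
      then show False using hin(2)[OF ij(1,2)] by blast
    qed
    then have "i = i'" using bij_betw_imp_inj_on[OF g] ij by (auto dest: inj_onD)
    moreover have "j = j'"
      using bij_betw_imp_inj_on[OF h[OF ij(1)]] ij eq \<open>i = i'\<close> by (auto dest: inj_onD)
    ultimately show ?thesis ..
  qed
  have "inj_on F (verts ?S)"
    unfolding SV by (rule inj_onI) (auto simp: F dest: hinj hin(2) sym)
  moreover have "F ` verts ?S = V"
  proof
    show "F ` verts ?S \<subseteq> V"
      unfolding SV using w hin(1) gE edge_subset by (fastforce simp: F)
    show "V \<subseteq> F ` verts ?S"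
    proof
      fix v assume v: "v \<in> V"
      show "v \<in> F ` verts ?S"
      proof (cases "v = w")
        case True
        then show ?thesis unfolding SV using F(1) by blast
      next
        case False
        then obtain e where e: "e \<in> E" "v \<in> e" using univ[OF v] by (auto simp: adjr_def)
        then obtain i where i: "i < m" "e = g i" using g by (auto simp: bij_betw_def)
        then obtain j where j: "j < k - 1" "v = h i j" using him[OF i(1)] e False by blast
        then have "v = F (Some (i, j))" by (simp add: F)
        then show ?thesis unfolding SV using i j by blast
      qed
    qed
  qed
  ultimately have "bij_betw F (verts ?S) V" by (simp add: bij_betw_def)
  moreover have "E = (\<lambda>e. F ` e) ` edges ?S"
  proof -
    have "F ` insert None ((\<lambda>j. Some (i, j)) ` {..<k - 1}) = g i" if "i < m" for i
    proof -
      have "F ` insert None ((\<lambda>j. Some (i, j)) ` {..<k - 1}) = insert w (h i ` {..<k - 1})"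
        by (simp add: image_image F)
      also have "\<dots> = g i" using him[OF that] we[OF gE[OF that]] by (simp add: insert_absorb)
      finally show ?thesis .
    qed
    then have "(\<lambda>e. F ` e) ` edges ?S = g ` {..<m}"
      unfolding SE image_image by (intro image_cong) auto
    then show ?thesis using g by (simp add: bij_betw_def)
  qed
  ultimately show ?thesis unfolding hyperiso_def m_def by blast
qed

text \<open>The second vertex of a path between distinct non-adjacent vertices lies in the first two
  edges of the path, which are distinct.\<close>

lemma ex_branching_vertex:
  assumes v: "u \<in> V" "v \<in> V" "v \<noteq> u" "(u, v) \<notin> adj"
  obtains w e1 e2 where "e1 \<in> E" "w \<in> e1" "e2 \<in> E" "w \<in> e2" "e1 \<noteq> e2"
proof -
  obtain vs es where "hpath G u vs es v" using conn v(1,2) unfolding hconnected_def by blast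
  then have p: "hwalk G u vs es v" "distinct es" by (auto simp: hpath_def)
  have "(u, v) \<in> adj ^^ length es" using hwalk_imp_relpow[OF p(1)] .
  \<comment> \<open>Length 0 would force \<open>v = u\<close>, and length 1 would make
    \<open>u\<close> and \<open>v\<close> adjacent.\<close>
  then have len: "length es \<ge> 2" using v by (cases "length es"; cases "length es - 1") auto
  have "es ! 0 \<in> E" "es ! 1 \<in> E"
    using p(1) len nth_mem[of 0 es] nth_mem[of 1 es] unfolding hwalk_def by fastforce+
  moreover have "vs ! 1 \<in> es ! 0" "vs ! 1 \<in> es ! 1"
    using p(1) len unfolding hwalk_def by fastforce+
  moreover have "es ! 0 \<noteq> es ! 1" using nth_eq_iff_index_eq[OF p(2), of 0 1] len by linarith
  ultimately show ?thesis using that by blast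
qed

end

theorem theorem4p4:
  fixes T :: "'a hypergraph" and k n :: nat
  assumes "k \<ge> 2"
    and "hypertree T"
    and "uniform k T"
    and "card (verts T) = n"
    and "(real n - 1) / (real k - 1) \<ge> 1"
  shows "distance_spectral_radius T \<ge> distance_spectral_radius (hyperstar n k) \<and>
    (distance_spectral_radius T = distance_spectral_radius (hyperstar n k)
       \<longleftrightarrow> hyperiso T (hyperstar n k))"
proof -
  interpret hypertree_loc T
    using assms(2) by unfold_locales (auto simp: hypertree_def)
  define m where "m = card E"
  have n: "n = 1 + (k - 1) * m"
    using card_verts_uniform[OF assms(3)] assms(1,4) by (simp add: m_def)
  \<comment> \<open>For \<open>m = 0\<close> the order would be 1 and the quotient in the hypothesis
    0.\<close>
  have m: "m \<ge> 1"
    using assms(5) n by (cases m) auto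
  note S = distance_spectral_radius_hyperstar[OF assms(1) m, folded n]
  note hS = hypergraph_hyperstar[OF assms(1), of m, folded n]
  show ?thesis
  proof (cases "hyperiso T (hyperstar n k)")
    case True
    then show ?thesis using distance_spectral_radius_iso[OF hyp hS] by simp
  next
    case False
    \<comment> \<open>Applied twice: at an arbitrary vertex, to produce a branching vertex, and then
      at that branching vertex, to produce \<open>v0\<close>.\<close>
    have nonadj: "\<exists>v\<in>V. v \<noteq> w \<and> (w, v) \<notin> adj" if "w \<in> V" for w
    proof (rule ccontr)
      assume "\<not> ?thesis"
      then have "hyperiso (hyperstar n k) T"
        unfolding n m_def using universal_vertex_imp_hyperstar[OF assms(3,1) that] by blast
      then show False using hyperiso_sym[OF hS] False by blast
    qed
    obtain u where u: "u \<in> V" using verts_nonempty by blast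
    then obtain v where v: "v \<in> V" "v \<noteq> u" "(u, v) \<notin> adj" using nonadj by blast
    obtain w e1 e2 where w: "e1 \<in> E" "w \<in> e1" "e2 \<in> E" "w \<in> e2" "e1 \<noteq> e2"
      by (rule ex_branching_vertex[OF u v])
    then obtain v0 where v0: "v0 \<in> V" "v0 \<noteq> w" "(w, v0) \<notin> adj"
      using nonadj[of w] edge_subset by blast
    \<comment> \<open>Strict inequality in the non-isomorphic case gives the bound and excludes
      equality at once.\<close>
    have "distance_spectral_radius T > star_radius k m"
      unfolding m_def by (rule dist_radius_gt_star[OF assms(3,1) w v0])
    then show ?thesis using S False by simp
  qed
qed

end
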